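(* Let $\mathcal{E}=\{f\in L^\infty(\mathbb{T}):0\le f(x)\le1\text{ for almost every }x\in\mathbb{T}\}$, with the topology induced by the $L^\infty$ norm. Then $\mathbb{P}^f$ determines $f$ up to translation and flip, except possibly for a meagre set of functions in $\mathcal{E}$. That is, there exists a meagre set $\mathcal{G}\subset\mathcal{E}$ such that for every $f\in\mathcal{E}\setminus\mathcal{G}$ and every $g\in\mathcal{E}$ with $\mathbb{P}^g=\mathbb{P}^f$, there is $\xi\in\mathbb{T}$ such that either $g(x)=f(x+\xi)$ for almost every $x\in\mathbb{T}$, or $g(x)=f(-x+\xi)$ for almost every $x\in\mathbb{T}$.
   Context: $\mathbb{T}=[0,1]$ with endpoints identified (the circle), with addition modulo $1$. For $f\in\mathcal{E}$, let $\hat f(k)=\int_0^1 f(x)e^{-2\pi i kx}\,dx$. $\mathbb{P}^f$ denotes the law of the determinantal point process on $\mathbb{Z}$ obtained from $f$, i.e. the law of the random subset of $\mathbb{Z}$ such that for all distinct $k_1,\dots,k_n\in\mathbb{Z}$ the probability that $k_1,\dots,k_n$ all belong to it is $\det\left(\hat f(k_i-k_j)\right)_{i,j=1}^n$. A subset of a topological space is meagre if it is a countable union of nowhere dense sets. *)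

theory Defs
  imports
    "HOL-Probability.Probability"
    "Jordan_Normal_Form.Determinant"
begin

section \<open>The circle and its space of essentially bounded functions\<close>

text \<open>
  Points of the circle are represented by their representatives in \<open>[0,1)\<close>; addition is
  \<open>frac (x + y)\<close>. A function on the circle is a function on the reals of which only the values
  on \<open>[0,1)\<close> matter.
\<close>

definition circle :: "real set"
  where "circle = {0..<1}"

definition circle_measure :: "real measure"
  where "circle_measure = restrict_space lborel circle"

definition ess_bounded :: "(real \<Rightarrow> real) \<Rightarrow> bool"
  where "ess_bounded f \<longleftrightarrow>
    f \<in> borel_measurable circle_measure \<and> (\<exists>C. AE x in circle_measure. \<bar>f x\<bar> \<le> C)"

definition linfty_rel :: "(real \<Rightarrow> real) \<Rightarrow> (real \<Rightarrow> real) \<Rightarrow> bool"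
  where "linfty_rel f g \<longleftrightarrow>
    ess_bounded f \<and> ess_bounded g \<and> (AE x in circle_measure. f x = g x)"

lemma ess_boundedI:
  "f \<in> borel_measurable circle_measure \<Longrightarrow> (AE x in circle_measure. \<bar>f x\<bar> \<le> C) \<Longrightarrow> ess_bounded f"
  by (auto simp: ess_bounded_def)

lemma ess_bounded_measurable: "ess_bounded f \<Longrightarrow> f \<in> borel_measurable circle_measure"
  by (simp add: ess_bounded_def)

lemma ess_bounded_const: "ess_bounded (\<lambda>x. c)"
  by (rule ess_boundedI[where C = "\<bar>c\<bar>"]) auto

lemma ess_bounded_add:
  assumes "ess_bounded f" "ess_bounded g"
  shows "ess_bounded (\<lambda>x. f x + g x)"
proof -
  obtain C D where "AE x in circle_measure. \<bar>f x\<bar> \<le> C" "AE x in circle_measure. \<bar>g x\<bar> \<le> D"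
    using assms by (auto simp: ess_bounded_def)
  then have "AE x in circle_measure. \<bar>f x + g x\<bar> \<le> C + D"
    by eventually_elim auto
  then show ?thesis
    using assms[THEN ess_bounded_measurable] by (intro ess_boundedI) auto
qed

lemma ess_bounded_scale:
  assumes "ess_bounded f"
  shows "ess_bounded (\<lambda>x. c * f x)"
proof -
  obtain C where "AE x in circle_measure. \<bar>f x\<bar> \<le> C"
    using assms by (auto simp: ess_bounded_def)
  then have "AE x in circle_measure. \<bar>c * f x\<bar> \<le> \<bar>c\<bar> * C"
    by eventually_elim (auto simp: abs_mult intro: mult_left_mono)
  then show ?thesis
    using assms[THEN ess_bounded_measurable] by (intro ess_boundedI) auto
qed

quotient_type linfty = "real \<Rightarrow> real" / partial: linfty_rel
proof (rule part_equivpI)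
  show "\<exists>f. linfty_rel f f"
    by (rule exI[of _ "\<lambda>_. 0"]) (simp add: linfty_rel_def ess_bounded_const)
  show "symp linfty_rel"
    by (auto simp: symp_def linfty_rel_def)
  show "transp linfty_rel"
    unfolding transp_def linfty_rel_def by auto
qed

lemma ess_bounded_rep_linfty: "ess_bounded (rep_linfty f)"
  using Quotient3_rep_reflp[OF Quotient3_linfty, of f] by (simp add: linfty_rel_def)

lemma rep_abs_linfty:
  assumes "ess_bounded f"
  shows "AE x in circle_measure. rep_linfty (abs_linfty f) x = f x"
  using Quotient3_rep_abs[OF Quotient3_linfty, of f] assms by (simp add: linfty_rel_def)

lemma linfty_eq_iff:
  "f = g \<longleftrightarrow> (AE x in circle_measure. rep_linfty f x = rep_linfty g x)"
  using Quotient3_rel_rep[OF Quotient3_linfty, of f g]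
  by (auto simp: linfty_rel_def ess_bounded_rep_linfty)

instantiation linfty :: real_vector
begin

definition zero_linfty_def: "0 = abs_linfty (\<lambda>x. 0)"
definition plus_linfty_def: "f + g = abs_linfty (\<lambda>x. rep_linfty f x + rep_linfty g x)"
definition scaleR_linfty_def: "c *\<^sub>R f = abs_linfty (\<lambda>x. c * rep_linfty f x)"
definition uminus_linfty_def: "- f = (-1) *\<^sub>R (f :: linfty)"
definition minus_linfty_def: "f - g = f + - (g :: linfty)"

lemma rep_zero: "AE x in circle_measure. rep_linfty 0 x = 0"
  unfolding zero_linfty_def by (rule rep_abs_linfty[OF ess_bounded_const])

lemma rep_plus: "AE x in circle_measure. rep_linfty (f + g) x = rep_linfty f x + rep_linfty g x"
  unfolding plus_linfty_def
  by (intro rep_abs_linfty ess_bounded_add ess_bounded_rep_linfty)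

lemma rep_scaleR: "AE x in circle_measure. rep_linfty (c *\<^sub>R f) x = c * rep_linfty f x"
  unfolding scaleR_linfty_def
  by (intro rep_abs_linfty ess_bounded_scale ess_bounded_rep_linfty)

lemma rep_uminus: "AE x in circle_measure. rep_linfty (- f) x = - rep_linfty f x"
  unfolding uminus_linfty_def using rep_scaleR[of "-1" f] by eventually_elim simp

lemma rep_minus: "AE x in circle_measure. rep_linfty (f - g) x = rep_linfty f x - rep_linfty g x"
  unfolding minus_linfty_def using rep_plus[of f "- g"] rep_uminus[of g]
  by eventually_elim simp

instance
proof
  fix f g h :: linfty and a b :: real
  show "f + g + h = f + (g + h)"
    unfolding linfty_eq_iff
    using rep_plus[of "f + g" h] rep_plus[of f g] rep_plus[of f "g + h"] rep_plus[of g h]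
    by eventually_elim simp
  show "f + g = g + f"
    unfolding linfty_eq_iff using rep_plus[of f g] rep_plus[of g f] by eventually_elim simp
  show "0 + f = f"
    unfolding linfty_eq_iff using rep_plus[of 0 f] rep_zero by eventually_elim simp
  show "- f + f = 0"
    unfolding linfty_eq_iff using rep_plus[of "- f" f] rep_uminus[of f] rep_zero
    by eventually_elim simp
  show "f - g = f + - g"
    by (rule minus_linfty_def)
  show "a *\<^sub>R (f + g) = a *\<^sub>R f + a *\<^sub>R g"
    unfolding linfty_eq_iff
    using rep_plus[of f g] rep_scaleR[of a "f + g"] rep_plus[of "a *\<^sub>R f" "a *\<^sub>R g"]
      rep_scaleR[of a f] rep_scaleR[of a g]
    by eventually_elim (simp add: algebra_simps)
  show "(a + b) *\<^sub>R f = a *\<^sub>R f + b *\<^sub>R f"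
    unfolding linfty_eq_iff
    using rep_scaleR[of "a + b" f] rep_plus[of "a *\<^sub>R f" "b *\<^sub>R f"]
      rep_scaleR[of a f] rep_scaleR[of b f]
    by eventually_elim (simp add: algebra_simps)
  show "a *\<^sub>R b *\<^sub>R f = (a * b) *\<^sub>R f"
    unfolding linfty_eq_iff
    using rep_scaleR[of a "b *\<^sub>R f"] rep_scaleR[of b f] rep_scaleR[of "a * b" f]
    by eventually_elim simp
  show "1 *\<^sub>R f = f"
    unfolding linfty_eq_iff using rep_scaleR[of 1 f] by eventually_elim simp
qed

end

instantiation linfty :: real_normed_vector
begin

definition norm_linfty_def:
  "norm f = real_of_ereal (esssup circle_measure (\<lambda>x. ereal \<bar>rep_linfty f x\<bar>))"
definition dist_linfty_def: "dist f g = norm (f - g :: linfty)"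
definition sgn_linfty_def: "sgn f = f /\<^sub>R norm (f :: linfty)"
definition uniformity_linfty_def:
  "(uniformity :: (linfty \<times> linfty) filter) = (INF e\<in>{0 <..}. principal {(f, g). dist f g < e})"
definition open_linfty_def:
  "open (U :: linfty set) \<longleftrightarrow> (\<forall>f\<in>U. eventually (\<lambda>(f', g). f' = f \<longrightarrow> g \<in> U) uniformity)"

lemma emeasure_circle_space: "emeasure circle_measure (space circle_measure) = 1"
  by (simp add: circle_measure_def circle_def space_restrict_space emeasure_restrict_space)

lemma esssup_linfty:
  "0 \<le> esssup circle_measure (\<lambda>x. ereal \<bar>rep_linfty f x\<bar>)"
  "esssup circle_measure (\<lambda>x. ereal \<bar>rep_linfty f x\<bar>) = ereal (norm f)"
proof -
  have m: "(\<lambda>x. ereal \<bar>rep_linfty f x\<bar>) \<in> borel_measurable circle_measure"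
    using ess_bounded_measurable[OF ess_bounded_rep_linfty] by measurable
  obtain C where "AE x in circle_measure. \<bar>rep_linfty f x\<bar> \<le> C"
    using ess_bounded_rep_linfty[of f] by (auto simp: ess_bounded_def)
  then have le: "esssup circle_measure (\<lambda>x. ereal \<bar>rep_linfty f x\<bar>) \<le> ereal C"
    using m by (intro esssup_I) auto
  have "esssup circle_measure (\<lambda>x. 0::ereal) \<le> esssup circle_measure (\<lambda>x. ereal \<bar>rep_linfty f x\<bar>)"
    by (rule esssup_mono) auto
  moreover have "esssup circle_measure (\<lambda>x. 0::ereal) = 0"
    by (rule esssup_const) (simp add: emeasure_circle_space)
  ultimately show ge: "0 \<le> esssup circle_measure (\<lambda>x. ereal \<bar>rep_linfty f x\<bar>)"
    by simp
  show "esssup circle_measure (\<lambda>x. ereal \<bar>rep_linfty f x\<bar>) = ereal (norm f)"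
    unfolding norm_linfty_def using le ge
    by (cases "esssup circle_measure (\<lambda>x. ereal \<bar>rep_linfty f x\<bar>)") auto
qed

lemma AE_le_norm_linfty: "AE x in circle_measure. \<bar>rep_linfty f x\<bar> \<le> norm f"
  using esssup_AE[where M = circle_measure and f = "\<lambda>x. ereal \<bar>rep_linfty f x\<bar>"]
  unfolding esssup_linfty by simp

lemma norm_linfty_nonneg: "0 \<le> norm (f :: linfty)"
  using esssup_linfty[of f] by simp

lemma norm_linfty_leI:
  assumes "AE x in circle_measure. \<bar>rep_linfty f x\<bar> \<le> c"
  shows "norm f \<le> c"
proof -
  have m: "(\<lambda>x. ereal \<bar>rep_linfty f x\<bar>) \<in> borel_measurable circle_measure"
    using ess_bounded_measurable[OF ess_bounded_rep_linfty] by measurable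
  have "esssup circle_measure (\<lambda>x. ereal \<bar>rep_linfty f x\<bar>) \<le> ereal c"
    using m assms by (intro esssup_I) auto
  then show ?thesis
    by (simp add: esssup_linfty(2))
qed

lemma norm_linfty_scaleR_le: "norm (a *\<^sub>R f) \<le> \<bar>a\<bar> * norm (f :: linfty)"
  by (rule norm_linfty_leI, use AE_le_norm_linfty[of f] rep_scaleR[of a f] in eventually_elim)
    (auto simp: abs_mult intro: mult_left_mono)

instance
proof
  fix f g :: linfty and a :: real
  show "dist f g = norm (f - g)"
    by (rule dist_linfty_def)
  show "sgn f = f /\<^sub>R norm f"
    by (rule sgn_linfty_def)
  show "(uniformity :: (linfty \<times> linfty) filter) = (INF e\<in>{0 <..}. principal {(f, g). dist f g < e})"
    by (rule uniformity_linfty_def)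
  show "open U \<longleftrightarrow> (\<forall>f\<in>U. \<forall>\<^sub>F (f', g) in uniformity. f' = f \<longrightarrow> g \<in> U)" for U :: "linfty set"
    by (rule open_linfty_def)
  show "norm f = 0 \<longleftrightarrow> f = 0"
  proof
    assume "norm f = 0"
    then show "f = 0"
      unfolding linfty_eq_iff using AE_le_norm_linfty[of f] rep_zero
      by (auto elim: eventually_elim2)
  next
    assume "f = 0"
    then have "norm f \<le> 0"
      using rep_zero by (intro norm_linfty_leI) auto
    then show "norm f = 0"
      using norm_linfty_nonneg[of f] by simp
  qed
  show "norm (f + g) \<le> norm f + norm g"
    by (rule norm_linfty_leI,
        use AE_le_norm_linfty[of f] AE_le_norm_linfty[of g] rep_plus[of f g] in eventually_elim)
      auto
  show "norm (a *\<^sub>R f) = \<bar>a\<bar> * norm f"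
  proof (cases "a = 0")
    case True
    then show ?thesis
      using norm_linfty_scaleR_le[of a f] norm_linfty_nonneg[of "a *\<^sub>R f"] by simp
  next
    case False
    have "norm f = norm (inverse a *\<^sub>R a *\<^sub>R f)"
      using False by simp
    also have "\<dots> \<le> \<bar>inverse a\<bar> * norm (a *\<^sub>R f)"
      by (rule norm_linfty_scaleR_le)
    finally have "\<bar>a\<bar> * norm f \<le> norm (a *\<^sub>R f)"
      using False by (simp add: field_simps)
    then show ?thesis
      using norm_linfty_scaleR_le[of a f] by simp
  qed
qed

end

text \<open>
  \<open>rep_linfty f\<close> is an unspecified representative of the class \<open>f\<close>; below it occurs only in ways that
  do not depend on the choice (almost everywhere statements and integrals).
\<close>

definition unit_functions :: "linfty set"
  where "unit_functions =
    {f. AE x in circle_measure. 0 \<le> rep_linfty f x \<and> rep_linfty f x \<le> 1}"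

definition fourier_coeff :: "linfty \<Rightarrow> int \<Rightarrow> complex"
  where "fourier_coeff f k =
    (LINT x|circle_measure.
       complex_of_real (rep_linfty f x) * exp (- 2 * complex_of_real pi * \<i> * of_int k * of_real x))"


section \<open>Determinantal point processes on the integers\<close>

text \<open>
  The law of a random subset of the integers is a probability measure on the product
  \<open>\<sigma>\<close>-algebra of the power set, generated by the events that a given integer belongs to the set.
\<close>

definition subset_algebra :: "int set measure"
  where "subset_algebra = sigma UNIV (range (\<lambda>k. {A. k \<in> A}))"

definition determinantal_law :: "linfty \<Rightarrow> int set measure \<Rightarrow> bool"
  where "determinantal_law f P \<longleftrightarrow>
    prob_space P \<and> sets P = sets subset_algebra \<and>
    (\<forall>n. \<forall>k :: nat \<Rightarrow> int. inj_on k {0..<n} \<longrightarrow>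
      complex_of_real (measure P {A. \<forall>i<n. k i \<in> A}) =
        Determinant.det (Matrix.mat n n (\<lambda>(i, j). fourier_coeff f (k i - k j))))"

text \<open>
  The inclusion probabilities are the probabilities of an intersection-stable generator, so there
  is at most one such law, and it makes sense to speak of the determinantal law of \<open>f\<close>.
\<close>

lemma determinantal_law_unique:
  assumes "determinantal_law f P" "determinantal_law f Q"
  shows "P = Q"
proof -
  define E where "E = (\<lambda>K :: int set. {A. K \<subseteq> A}) ` {K. finite K}"
  interpret P: prob_space P
    using assms by (simp add: determinantal_law_def)
  interpret Q: prob_space Q
    using assms by (simp add: determinantal_law_def)
  have setsP: "sets P = sigma_sets UNIV (range (\<lambda>k. {A. k \<in> A}))"
    and setsQ: "sets Q = sigma_sets UNIV (range (\<lambda>k. {A. k \<in> A}))"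
    using assms by (simp_all add: determinantal_law_def subset_algebra_def)
  have E_sets: "{A. K \<subseteq> A} \<in> sigma_sets UNIV (range (\<lambda>k. {A. k \<in> A}))" if "finite K" for K :: "int set"
    using that
  proof (induction K)
    case empty
    then show ?case
      using sigma_sets_top[of UNIV] by simp
  next
    case (insert k K)
    have "{A. insert k K \<subseteq> A} = {A. k \<in> A} \<inter> {A. K \<subseteq> A}"
      by auto
    also have "\<dots> \<in> sigma_sets UNIV (range (\<lambda>k. {A. k \<in> A}))"
      using insert sets.Int[of "{A. k \<in> A}" P "{A. K \<subseteq> A}"] by (auto simp: setsP)
    finally show ?case .
  qed
  have gen: "sigma_sets UNIV (range (\<lambda>k. {A. k \<in> A})) = sigma_sets UNIV E"
  proof (rule sigma_sets_eqI)
    show "a \<in> sigma_sets UNIV E" if a: "a \<in> range (\<lambda>k. {A. k \<in> A})" for a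
    proof -
      obtain k where "a = {A. k \<in> A}"
        using a by blast
      then have "a \<in> E"
        unfolding E_def by (intro image_eqI[of _ _ "{k}"]) auto
      then show ?thesis ..
    qed
    show "b \<in> sigma_sets UNIV (range (\<lambda>k. {A. k \<in> A}))" if "b \<in> E" for b
      using that E_sets by (auto simp: E_def)
  qed
  have "emeasure P X = emeasure Q X" if X: "X \<in> E" for X
  proof -
    obtain K :: "int set" where K: "finite K" "X = {A. K \<subseteq> A}"
      using X by (auto simp: E_def)
    obtain k where k: "bij_betw k {0..<card K} K"
      using ex_bij_betw_nat_finite[OF K(1)] by blast
    have im: "k ` {0..<card K} = K"
      using k by (rule bij_betw_imp_surj_on)
    have "K \<subseteq> A \<longleftrightarrow> (\<forall>i<card K. k i \<in> A)" for A
      by (subst im[symmetric]) auto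
    then have "X = {A. \<forall>i<card K. k i \<in> A}"
      using K(2) by simp
    then have "complex_of_real (measure P X) = complex_of_real (measure Q X)"
      using assms k by (simp add: determinantal_law_def bij_betw_def)
    then show ?thesis
      by (simp add: P.emeasure_eq_measure Q.emeasure_eq_measure)
  qed
  moreover have "UNIV \<in> E"
    unfolding E_def by (rule image_eqI[of _ _ "{}"]) auto
  moreover have "Int_stable E"
    unfolding Int_stable_def E_def
  proof safe
    fix K L :: "int set"
    assume "finite K" "finite L"
    then show "{A. K \<subseteq> A} \<inter> {A. L \<subseteq> A} \<in> (\<lambda>K. {A. K \<subseteq> A}) ` {K. finite K}"
      by (intro image_eqI[of _ _ "K \<union> L"]) auto
  qed
  ultimately show ?thesis
    using setsP setsQ gen
    by (intro measure_eqI_generator_eq[where E = E and \<Omega> = UNIV and A = "\<lambda>_. UNIV"]) auto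
qed


section \<open>Meagre sets\<close>

definition nowhere_dense_in :: "'a topology \<Rightarrow> 'a set \<Rightarrow> bool"
  where "nowhere_dense_in X S \<longleftrightarrow> S \<subseteq> topspace X \<and> X interior_of (X closure_of S) = {}"

definition meagre_in :: "'a topology \<Rightarrow> 'a set \<Rightarrow> bool"
  where "meagre_in X S \<longleftrightarrow>
    (\<exists>\<N>. countable \<N> \<and> (\<forall>N\<in>\<N>. nowhere_dense_in X N) \<and> S = \<Union>\<N>)"

end

theory Submission
  imports Defs
begin

text \<open>
  Correlation functions of order at most three already suffice. They determine \<open>a 0\<close>, the moduli
  \<open>\<bar>a k\<bar>\<close> and the real parts of the bispectrum \<open>a j * a k * cnj (a (j + k))\<close>, where \<open>a\<close> is the
  sequence of Fourier coefficients. A rigid motion of the circle normalises \<open>a 1\<close> and \<open>a 2\<close>. Knowing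
  the coefficients below \<open>n\<close>, each decomposition \<open>n = j + k\<close> leaves two candidates for \<open>a n\<close>, and for
  generic \<open>a\<close> the decompositions \<open>1 + (n - 1)\<close> and \<open>2 + (n - 2)\<close> have only the true one in common. For
  \<open>n = 3\<close> these coincide, and the ambiguity is resolved together with that of \<open>a 4\<close> by
  \<open>1 + 3 = 2 + 2\<close>.

  Genericity means that certain products of coefficients are not real. Along the segment from \<open>f\<close> to
  \<open>p\<close> the imaginary part of such a product is a polynomial, so if it does not vanish at one fixed
  \<open>p\<close>, then it vanishes only on a nowhere dense set. The function \<open>p x = exp (- x)\<close> serves all
  products at once.
\<close>

section \<open>Fourier uniqueness on the circle\<close>

definition character :: "int \<Rightarrow> real \<Rightarrow> complex"
  where "character k x = cis (2 * pi * of_int k * x)"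

lemma character_add: "character (j + k) x = character j x * character k x"
  by (simp add: character_def cis_mult algebra_simps)

lemma character_zero [simp]: "character 0 x = 1"
  by (simp add: character_def)

lemma norm_character [simp]: "norm (character k x) = 1"
  by (simp add: character_def)

lemma character_measurable [measurable]: "character k \<in> borel_measurable borel"
  unfolding character_def cis_conv_exp by measurable

lemma cnj_character: "cnj (character k x) = character (- k) x"
  by (simp add: character_def cis_cnj)

lemma fourier_coeff_character:
  "fourier_coeff f k =
    (LINT x|circle_measure. complex_of_real (rep_linfty f x) * character (- k) x)"
  unfolding fourier_coeff_def character_def cis_conv_exp
  by (intro Bochner_Integration.integral_cong refl) (simp add: mult_ac)

text \<open>Only monomials and sums are built in, so that equality of integrals reduces to single
  characters by induction. Closure under products comes from \<open>character_add\<close>.\<close>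

inductive trig_poly :: "(real \<Rightarrow> complex) \<Rightarrow> bool" where
  monomial: "trig_poly (\<lambda>x. c * character k x)"
| add: "trig_poly p \<Longrightarrow> trig_poly q \<Longrightarrow> trig_poly (\<lambda>x. p x + q x)"

lemma trig_poly_const: "trig_poly (\<lambda>x. c)"
  using trig_poly.monomial[of c 0] by simp

lemma trig_poly_monomial_mult: "trig_poly q \<Longrightarrow> trig_poly (\<lambda>x. c * character k x * q x)"
proof (induction rule: trig_poly.induct)
  case (monomial d j)
  show ?case
    using trig_poly.monomial[of "c * d" "k + j"] by (simp add: character_add mult_ac)
next
  case (add p q)
  then show ?case
    using trig_poly.add by (simp add: distrib_left)
qed

lemma trig_poly_mult: "trig_poly p \<Longrightarrow> trig_poly q \<Longrightarrow> trig_poly (\<lambda>x. p x * q x)"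
proof (induction rule: trig_poly.induct)
  case (monomial c k)
  then show ?case
    by (rule trig_poly_monomial_mult)
next
  case (add p p')
  then show ?case
    using trig_poly.add by (simp add: distrib_right)
qed

text \<open>A real-linear functional on the plane is a combination of \<open>z\<close> and
  \<open>cnj z\<close>, and on the unit circle conjugation turns \<open>character 1\<close> into
  \<open>character (- 1)\<close>. The other cases are closure properties.\<close>

lemma trig_poly_real_polynomial_function:
  assumes "real_polynomial_function g"
  shows "trig_poly (\<lambda>x. complex_of_real (g (character 1 x)))"
  using assms
proof (induction rule: real_polynomial_function.induct)
  case (linear f)
  interpret bounded_linear f
    by fact
  have f_eq: "f z = f 1 * Re z + f \<i> * Im z" for z
  proof -
    have "z = Re z *\<^sub>R 1 + Im z *\<^sub>R \<i>"
      by (simp add: complex_eq_iff)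
    then have "f z = Re z *\<^sub>R f 1 + Im z *\<^sub>R f \<i>"
      by (metis add scaleR)
    then show ?thesis
      by simp
  qed
  \<comment> \<open>From \<open>Re z = (z + cnj z) / 2\<close> and
    \<open>Im z = (z - cnj z) / 2 * (- \<i>)\<close>.\<close>
  define c d where "c = complex_of_real (f 1) / 2" and "d = complex_of_real (f \<i>) / 2 * (- \<i>)"
  have "complex_of_real (f z) = c * (z + cnj z) + d * (z - cnj z)" for z
    unfolding complex_add_cnj complex_diff_cnj c_def d_def
    by (subst f_eq[of z]) (simp add: complex_eq_iff)
  also have "c * (z + w) + d * (z - w) = (c + d) * z + (c - d) * w" for z w
    by (simp add: algebra_simps)
  finally have eq: "(\<lambda>x. complex_of_real (f (character 1 x))) =
      (\<lambda>x. (c + d) * character 1 x + (c - d) * character (- 1) x)"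
    unfolding cnj_character[symmetric] by (intro ext)
  show ?case
    unfolding eq by (intro trig_poly.intros)
next
  case (const c)
  show ?case by (rule trig_poly_const)
next
  case (add f g)
  then show ?case
    using trig_poly.add by simp
next
  case (mult f g)
  then show ?case
    using trig_poly_mult by simp
qed

section \<open>Finite measures on the circle\<close>

lemma sets_circle_borel: "A \<in> sets circle_measure \<longleftrightarrow> A \<in> sets borel \<and> A \<subseteq> circle"
  by (auto simp: circle_measure_def circle_def sets_restrict_space_iff)

lemma space_circle_measure [simp]: "space circle_measure = circle"
  by (simp add: circle_measure_def space_restrict_space)

lemma prob_space_circle_measure: "prob_space circle_measure"
  by (rule prob_spaceI) (rule emeasure_circle_space)

lemma measurable_circle_borel:
  assumes "sets M = sets circle_measure" "h \<in> borel_measurable borel"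
  shows "h \<in> borel_measurable M"
proof -
  have "h \<in> borel_measurable circle_measure"
    unfolding circle_measure_def using assms(2) by (simp add: measurable_restrict_space1)
  then show ?thesis
    using measurable_cong_sets[OF assms(1) refl] by blast
qed

lemma integrable_bounded_borel:
  fixes h :: "real \<Rightarrow> 'b::{banach,second_countable_topology}"
  assumes "finite_measure M" "sets M = sets circle_measure" "h \<in> borel_measurable borel"
    "\<And>x. norm (h x) \<le> B"
  shows "integrable M h"
proof -
  interpret finite_measure M by fact
  show ?thesis
    using measurable_circle_borel[OF assms(2,3)] assms(4)
    by (intro integrable_const_bound[of _ B]) auto
qed

lemma trig_poly_measurable_bounded:
  assumes "trig_poly p"
  shows "p \<in> borel_measurable borel \<and> (\<exists>B. \<forall>x. norm (p x) \<le> B)"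
  using assms
proof (induction rule: trig_poly.induct)
  case (monomial c k)
  show ?case
    by (auto simp: norm_mult intro: exI[of _ "norm c"])
next
  case (add p q)
  then obtain B C where "\<forall>x. norm (p x) \<le> B" "\<forall>x. norm (q x) \<le> C"
    by auto
  then have "\<forall>x. norm (p x + q x) \<le> B + C"
    by (meson add_mono norm_triangle_le)
  then show ?case
    using add by auto
qed

lemma integral_trig_poly_eq:
  assumes M: "finite_measure M" "sets M = sets circle_measure"
    and N: "finite_measure N" "sets N = sets circle_measure"
    and eq: "\<And>k. (LINT x|M. character k x) = (LINT x|N. character k x)"
    and "trig_poly p"
  shows "(LINT x|M. p x) = (LINT x|N. p x)"
  using \<open>trig_poly p\<close>
proof (induction rule: trig_poly.induct)
  case (monomial c k)
  show ?case
    using eq by simp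
next
  case (add p q)
  have "integrable K p \<and> integrable K q" if "finite_measure K" "sets K = sets circle_measure" for K
  proof -
    obtain B C where "\<And>x. norm (p x) \<le> B" "\<And>x. norm (q x) \<le> C"
      using trig_poly_measurable_bounded add.hyps by metis
    then show ?thesis
      using integrable_bounded_borel[OF that] trig_poly_measurable_bounded add.hyps by metis
  qed
  then show ?case
    using add M N by simp
qed

text \<open>Stone-Weierstrass: on the unit circle \<open>\<phi>\<close> is a uniform limit of real
  polynomials. Along \<open>character 1\<close> these become trigonometric polynomials, whose
  integrals under \<open>M\<close> and \<open>N\<close> agree.\<close>

lemma integral_continuous_circle_eq:
  fixes \<phi> :: "complex \<Rightarrow> real"
  assumes M: "finite_measure M" "sets M = sets circle_measure"
    and N: "finite_measure N" "sets N = sets circle_measure"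
    and eq: "\<And>k. (LINT x|M. character k x) = (LINT x|N. character k x)"
    and cont: "continuous_on UNIV \<phi>"
  shows "(LINT x|M. \<phi> (character 1 x)) = (LINT x|N. \<phi> (character 1 x))"
proof -
  have \<phi>_meas: "\<phi> \<in> borel_measurable borel"
    using cont by (rule borel_measurable_continuous_onI)
  have "compact (\<phi> ` sphere 0 1)"
    using cont by (intro compact_continuous_image continuous_on_subset[OF cont]) auto
  then obtain B where B: "\<And>z. z \<in> sphere 0 1 \<Longrightarrow> norm (\<phi> z) \<le> B"
    using compact_imp_bounded bounded_iff by (metis imageI)
  define I where "I K = (LINT x|K. \<phi> (character 1 x))" for K
  have approx: "\<bar>I K - (LINT x|K. g (character 1 x))\<bar> \<le> e * measure K (space K)"
    if K: "finite_measure K" "sets K = sets circle_measure"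
      and g: "real_polynomial_function g" "\<And>z. z \<in> sphere 0 1 \<Longrightarrow> \<bar>\<phi> z - g z\<bar> < e"
    for K :: "real measure" and g e
  proof -
    interpret K: finite_measure K by fact
    have g_meas: "g \<in> borel_measurable borel"
      using continuous_on_polymonial_function g(1) real_polynomial_function_eq
      by (intro borel_measurable_continuous_onI) blast
    have int\<phi>: "integrable K (\<lambda>x. \<phi> (character 1 x))"
      using \<phi>_meas B by (intro integrable_bounded_borel[OF K, of _ B]) auto
    have gb: "norm (g (character 1 x)) \<le> B + e" for x
      using g(2)[of "character 1 x"] B[of "character 1 x"] by auto
    have intg: "integrable K (\<lambda>x. g (character 1 x))"
      using g_meas gb by (intro integrable_bounded_borel[OF K, of _ "B + e"]) auto
    have "I K - (LINT x|K. g (character 1 x)) = (LINT x|K. \<phi> (character 1 x) - g (character 1 x))"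
      unfolding I_def using int\<phi> intg by simp
    also have "\<bar>\<dots>\<bar> \<le> (LINT x|K. \<bar>\<phi> (character 1 x) - g (character 1 x)\<bar>)"
      by (rule integral_abs_bound)
    also have "\<dots> \<le> (LINT x|K. e)"
      using int\<phi> intg by (intro integral_mono) (auto intro!: less_imp_le g(2))
    finally show ?thesis
      by (simp add: mult.commute)
  qed
  have "\<bar>I M - I N\<bar> \<le> e" if "e > 0" for e
  proof -
    \<comment> \<open>The tolerance will be \<open>e / m\<close>; the summand 1 keeps
      \<open>m\<close> positive when both measures vanish.\<close>
    define m where "m = measure M (space M) + measure N (space N) + 1"
    have m: "m > 0"
      unfolding m_def by (simp add: add_nonneg_pos)
    obtain g where g: "real_polynomial_function g" "\<And>z. z \<in> sphere 0 1 \<Longrightarrow> \<bar>\<phi> z - g z\<bar> < e / m"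
      using Stone_Weierstrass_real_polynomial_function[of "sphere 0 1" \<phi> "e / m"] cont \<open>e > 0\<close> m
      by (metis compact_sphere continuous_on_subset divide_pos_pos subset_UNIV)
    have "complex_of_real (LINT x|M. g (character 1 x)) = complex_of_real (LINT x|N. g (character 1 x))"
      unfolding integral_complex_of_real[symmetric]
      by (rule integral_trig_poly_eq[OF M N eq trig_poly_real_polynomial_function[OF g(1)]])
    then have "\<bar>I M - I N\<bar> \<le> e / m * measure M (space M) + e / m * measure N (space N)"
      using approx[OF M g] approx[OF N g] by simp
    also have "\<dots> \<le> e / m * m"
      using \<open>e > 0\<close> m by (simp add: m_def distrib_left)
    finally show ?thesis
      using m by simp
  qed
  then have "I M = I N"
    by (metis abs_le_zero_iff dense_ge eq_iff_diff_eq_0)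
  then show ?thesis
    by (simp add: I_def)
qed

lemma character_one_inj:
  assumes "character 1 x = character 1 y" "x \<in> circle" "y \<in> circle"
  shows "x = y"
proof -
  have "cis (2 * pi * x) = cis (2 * pi * y)"
    using assms(1) by (simp add: character_def)
  then obtain n :: int where
    "\<i> * complex_of_real (2 * pi * x) = \<i> * complex_of_real (2 * pi * y) + (of_int (2 * n) * pi) * \<i>"
    unfolding cis_conv_exp exp_eq by auto
  then have "2 * pi * x = 2 * pi * y + 2 * pi * n"
    by (auto simp: complex_eq_iff)
  then have "2 * pi * x = 2 * pi * (y + of_int n)"
    by (simp add: algebra_simps)
  then have "x = y + of_int n"
    by simp
  moreover from this have "n = 0"
    using assms(2,3) by (auto simp: circle_def)
  ultimately show ?thesis
    by simp
qed

text \<open>The part of the circle beyond \<open>a\<close> is the preimage under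
  \<open>character 1\<close> of an open set, whose indicator is a pointwise limit of bounded
  continuous functions. By dominated convergence the measures agree on all such parts, which
  determines them.\<close>

theorem circle_measure_eqI_character:
  assumes M: "finite_measure M" "sets M = sets circle_measure"
    and N: "finite_measure N" "sets N = sets circle_measure"
    and eq: "\<And>k. (LINT x|M. character k x) = (LINT x|N. character k x)"
  shows "M = N"
proof -
  have spaces: "space M = circle" "space N = circle"
    using sets_eq_imp_space_eq[OF M(2)] sets_eq_imp_space_eq[OF N(2)] by auto
  have half: "measure M ({a<..} \<inter> circle) = measure N ({a<..} \<inter> circle)" for a
  proof -
    \<comment> \<open>\<open>C\<close> is the closed arc up to \<open>a\<close>, with
      \<open>a\<close> clamped to the unit interval. For \<open>a\<close> outside the circle,
      \<open>D\<close> is a point off the unit circle or the whole plane; it must be nonempty, since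
      \<open>infdist\<close> to the empty set is 0.\<close>
    define C where "C = character 1 ` {0..max 0 (min a 1)}"
    define D where "D = (if a < 0 then {2} else if a \<ge> 1 then UNIV else C)"
    have C: "compact C" "C \<noteq> {}"
      unfolding C_def character_def
      by (auto intro!: compact_continuous_image continuous_intros)
    then have D: "closed D" "D \<noteq> {}"
      by (auto simp: D_def compact_imp_closed)
    have mem: "character 1 x \<in> - D \<longleftrightarrow> a < x" if "x \<in> circle" for x
    proof -
      have "character 1 x \<noteq> 2"
        using norm_character[of 1 x] by (metis norm_numeral numeral_eq_one_iff semiring_norm(85))
      moreover have "character 1 x \<in> C \<longleftrightarrow> x \<le> a" if "0 \<le> a" "a < 1"
        using that \<open>x \<in> circle\<close> character_one_inj[of x] unfolding C_def
        by (auto simp: circle_def)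
      ultimately show ?thesis
        using that by (auto simp: D_def circle_def)
    qed
    \<comment> \<open>Truncated multiples of the distance to the closed set \<open>D\<close>
      converge to the indicator of its complement.\<close>
    define \<phi> where "\<phi> n z = min 1 (real n * infdist z D)" for n z
    have \<phi>_cont: "continuous_on UNIV (\<phi> n)" for n
      unfolding \<phi>_def by (intro continuous_intros)
    have \<phi>_lim: "(\<lambda>n. \<phi> n z) \<longlonglongrightarrow> indicator (- D) z" for z
    proof (cases "z \<in> D")
      case True
      then show ?thesis
        by (simp add: \<phi>_def)
    next
      case False
      then have "infdist z D > 0"
        using D infdist_pos_not_in_closed by blast
      then have "\<forall>\<^sub>F n in sequentially. 1 \<le> real n * infdist z D"
        by real_asymp
      then have "\<forall>\<^sub>F n in sequentially. \<phi> n z = 1"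
        by eventually_elim (simp add: \<phi>_def)
      then show ?thesis
        using False by (simp add: tendsto_eventually)
    qed
    have lim: "(\<lambda>n. LINT x|K. \<phi> n (character 1 x)) \<longlonglongrightarrow> measure K ({a<..} \<inter> circle)"
      if K: "finite_measure K" "sets K = sets circle_measure" for K
    proof -
      interpret K: finite_measure K by fact
      have sp: "space K = circle"
        using sets_eq_imp_space_eq[OF K(2)] by simp
      have "(\<lambda>n. LINT x|K. \<phi> n (character 1 x)) \<longlonglongrightarrow> (LINT x|K. indicator (- D) (character 1 x))"
      proof (rule integral_dominated_convergence[where w = "\<lambda>_. 1"])
        show "(\<lambda>x. indicator (- D) (character 1 x) :: real) \<in> borel_measurable K"
          using D by (intro measurable_circle_borel[OF K(2)]) measurable
        show "(\<lambda>x. \<phi> n (character 1 x)) \<in> borel_measurable K" for n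
          using measurable_compose[OF character_measurable borel_measurable_continuous_onI[OF \<phi>_cont]]
          by (intro measurable_circle_borel[OF K(2)])
      qed (use \<phi>_lim in \<open>auto simp: \<phi>_def infdist_nonneg\<close>)
      also have "(LINT x|K. indicator (- D) (character 1 x)) =
          (LINT x|K. indicator ({a<..} \<inter> circle) x :: real)"
        by (intro Bochner_Integration.integral_cong refl)
          (use mem in \<open>auto simp: sp indicator_def\<close>)
      also have "\<dots> = measure K ({a<..} \<inter> circle)"
        by (simp add: sp Int_absorb2)
      finally show ?thesis .
    qed
    show ?thesis
      using lim[OF N] lim[OF M] integral_continuous_circle_eq[OF M N eq \<phi>_cont]
      by (auto intro: LIMSEQ_unique)
  qed
  have id_meas: "(\<lambda>x. x) \<in> borel_measurable M" "(\<lambda>x. x) \<in> borel_measurable N"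
    using M N by (auto intro: measurable_circle_borel)
  \<comment> \<open>On the real line a measure finite on the half-lines \<open>{a<..}\<close> is
    determined by its values there.\<close>
  have "distr M borel (\<lambda>x. x) = distr N borel (\<lambda>x. x)"
  proof (rule measure_eqI_lessThan)
    fix a
    show "emeasure (distr M borel (\<lambda>x. x)) {a<..} < \<infinity>"
      using finite_measure.emeasure_finite[OF M(1)] id_meas by (simp add: emeasure_distr less_top)
    show "emeasure (distr M borel (\<lambda>x. x)) {a<..} = emeasure (distr N borel (\<lambda>x. x)) {a<..}"
      using half[of a] id_meas
      by (simp add: emeasure_distr spaces finite_measure.emeasure_eq_measure[OF M(1)]
          finite_measure.emeasure_eq_measure[OF N(1)])
  qed auto
  then have "emeasure M A = emeasure N A" if "A \<in> sets circle_measure" for A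
    using that id_meas emeasure_distr[of "\<lambda>x. x" M borel A] emeasure_distr[of "\<lambda>x. x" N borel A]
    by (auto simp: sets_circle_borel spaces Int_absorb2)
  then show ?thesis
    using M(2) N(2) by (intro measure_eqI) auto
qed


section \<open>Reconstruction from the first three correlation functions\<close>

lemma complex_Re_norm_eq_cases:
  fixes z w :: complex
  assumes "norm z = norm w" "Re z = Re w"
  shows "z = w \<or> z = cnj w"
proof -
  have "(Im z)\<^sup>2 = (Im w)\<^sup>2"
    using assms cmod_power2[of z] cmod_power2[of w] by simp
  then show ?thesis
    using assms(2) by (auto simp: complex_eq_iff power2_eq_iff)
qed

text \<open>In the application \<open>y\<close> is the true coefficient, \<open>x\<close> a
  candidate and \<open>c\<close> a product of two known coefficients. The second alternative says,
  without division, that \<open>x\<close> is the reflection of \<open>y\<close> in the real line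
  spanned by \<open>c\<close>.\<close>

lemma Re_mult_cnj_eq_cases:
  fixes c x y :: complex
  assumes "norm x = norm y" "Re (c * cnj x) = Re (c * cnj y)" "c \<noteq> 0"
  shows "x = y \<or> cnj c * x = c * cnj y"
proof -
  have "norm (c * cnj x) = norm (c * cnj y)"
    using assms(1) by (simp add: norm_mult)
  then have "c * cnj x = c * cnj y \<or> c * cnj x = cnj (c * cnj y)"
    using assms(2) by (rule complex_Re_norm_eq_cases)
  then show ?thesis
  proof
    assume "c * cnj x = c * cnj y"
    then show ?thesis
      using assms(3) by simp
  next
    assume "c * cnj x = cnj (c * cnj y)"
    then have "cnj (c * cnj x) = cnj (cnj (c * cnj y))"
      by simp
    then show ?thesis
      by simp
  qed
qed

lemma Im_eq_zero_iff_cnj: "Im z = 0 \<longleftrightarrow> z = cnj z"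
  by (auto simp: complex_eq_iff)

text \<open>Conjugates are treated as independent ring elements. In the application
  \<open>x\<close>, \<open>y\<close> are \<open>a 1\<close>, \<open>a 2\<close>, while
  \<open>c1\<close>, \<open>c2\<close>, \<open>c3\<close> are the conjugates of \<open>a 1\<close>,
  \<open>a 2\<close>, \<open>a 3\<close>, and \<open>u\<close>, \<open>v\<close> are the unknowns
  \<open>b 3\<close>, \<open>cnj (b 4)\<close>. Each conclusion is free of the unknowns and, once
  the common factor is cancelled, equates a product with its conjugate.\<close>

lemma
  fixes x y z w u v c1 c2 c3 c4 :: "'a :: comm_ring_1"
  assumes *: "c1 * c2 * u = x * y * c3"
  shows cross_multiply1: "x * u * c4 = c1 * c3 * z \<Longrightarrow>
      c3 * (x * x * y * c4) = c3 * (c1 * c1 * c2 * z)"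
    and cross_multiply2: "u * v = z * c4 \<Longrightarrow> y * y * v = c2 * c2 * w \<Longrightarrow>
      y * c2 * (x * c2 * c3 * w) = y * c2 * (c1 * y * z * c4)"
    and cross_multiply3: "x * u * v = c1 * c3 * w \<Longrightarrow> y * y * v = c2 * c2 * w \<Longrightarrow>
      w * y * c2 * c3 * (x * x * c2) = w * y * c2 * c3 * (c1 * c1 * y)"
proof -
  assume **: "x * u * c4 = c1 * c3 * z"
  have "c3 * (x * x * y * c4) = (c1 * c2 * u) * (x * c4)"
    unfolding * by (simp only: mult_ac)
  also have "\<dots> = c1 * c2 * (x * u * c4)"
    by (simp only: mult_ac)
  finally show "c3 * (x * x * y * c4) = c3 * (c1 * c1 * c2 * z)"
    unfolding ** by (simp only: mult_ac)
next
  assume **: "u * v = z * c4" and ***: "y * y * v = c2 * c2 * w"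
  have "y * c2 * (x * c2 * c3 * w) = (c1 * c2 * u) * (y * y * v)"
    unfolding * *** by (simp only: mult_ac)
  also have "\<dots> = c1 * c2 * y * y * (u * v)"
    by (simp only: mult_ac)
  finally show "y * c2 * (x * c2 * c3 * w) = y * c2 * (c1 * y * z * c4)"
    unfolding ** by (simp only: mult_ac)
next
  assume **: "x * u * v = c1 * c3 * w" and ***: "y * y * v = c2 * c2 * w"
  have "w * y * c2 * c3 * (x * x * c2) = x * (c1 * c2 * u) * (y * y * v)"
    unfolding * *** by (simp only: mult_ac)
  also have "\<dots> = c1 * c2 * y * y * (x * u * v)"
    by (simp only: mult_ac)
  finally show "w * y * c2 * c3 * (x * x * c2) = w * y * c2 * c3 * (c1 * c1 * y)"
    unfolding ** by (simp only: mult_ac)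
qed

text \<open>Primes play the role of conjugates. If reflecting one coefficient, with conjugate
  \<open>v\<close>, in the lines spanned by \<open>c\<close> and by \<open>d\<close> gives the same
  \<open>u\<close>, then up to the factor \<open>v\<close> the product \<open>c * d'\<close> equals
  its conjugate.\<close>

lemma cross_multiply4:
  fixes c d c' d' u v :: "'a :: comm_ring_1"
  assumes *: "c' * u = c * v" and **: "d' * u = d * v"
  shows "v * (c * d') = v * (c' * d)"
proof -
  have "v * (c * d') = (c' * u) * d'"
    unfolding * by (simp only: mult_ac)
  also have "\<dots> = c' * (d' * u)"
    by (simp only: mult_ac)
  finally show ?thesis
    unfolding ** by (simp only: mult_ac)
qed

text \<open>The conditions \<open>g1\<close>, \<open>g2\<close>, \<open>g3\<close> exclude the wrong
  candidate at index 3; \<open>g4\<close> excludes it at every later index and also keeps the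
  coefficients from vanishing.\<close>

lemma bispectrum_determines:
  fixes a b :: "nat \<Rightarrow> complex"
  assumes nrm: "\<And>k. norm (b k) = norm (a k)"
    and bis: "\<And>j k. j > 0 \<Longrightarrow> k > 0 \<Longrightarrow>
      Re (b j * b k * cnj (b (j + k))) = Re (a j * a k * cnj (a (j + k)))"
    and b1: "b 1 = a 1" and b2: "b 2 = a 2"
    and g1: "Im (a 1 * a 1 * cnj (a 2)) \<noteq> 0"
    and g2: "Im (a 1 * a 1 * a 2 * cnj (a 4)) \<noteq> 0"
    and g3: "Im (a 1 * cnj (a 2) * cnj (a 3) * a 4) \<noteq> 0"
    and g4: "\<And>k. k \<ge> 3 \<Longrightarrow> Im (a 1 * a k * cnj (a 2) * cnj (a (k - 1))) \<noteq> 0"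
    and "k > 0"
  shows "b k = a k"
proof -
  have nz: "a 1 \<noteq> 0" "a 2 \<noteq> 0" "a 3 \<noteq> 0" "a 4 \<noteq> 0"
    using g1 g3 by auto
  have nz': "a k \<noteq> 0" if "k \<ge> 3" for k
    using g4[OF that] by auto
  have b3: "b 3 = a 3"
  proof (rule ccontr)
    assume "b 3 \<noteq> a 3"
    then have e3: "cnj (a 1 * a 2) * b 3 = a 1 * a 2 * cnj (a 3)"
      using Re_mult_cnj_eq_cases[of "b 3" "a 3" "a 1 * a 2"] nrm bis[of 1 2] nz b1 b2
      by (simp add: numeral_eq_Suc)
    have b4: "b 4 = a 4 \<or> cnj (a 2 * a 2) * b 4 = a 2 * a 2 * cnj (a 4)"
      using Re_mult_cnj_eq_cases[of "b 4" "a 4" "a 2 * a 2"] nrm bis[of 2 2] nz b2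
      by simp
    have "norm (a 1 * b 3 * cnj (b 4)) = norm (a 1 * a 3 * cnj (a 4))"
      using nrm by (simp add: norm_mult)
    \<comment> \<open>Both \<open>b 3\<close> and \<open>b 4\<close> are undecided here, so the
      decomposition \<open>1 + 3\<close> yields an alternative for their product only.\<close>
    then have b34: "a 1 * b 3 * cnj (b 4) = a 1 * a 3 * cnj (a 4) \<or>
        a 1 * b 3 * cnj (b 4) = cnj (a 1 * a 3 * cnj (a 4))"
      using bis[of 1 3] b1 by (intro complex_Re_norm_eq_cases) auto
    \<comment> \<open>Of the four combinations, the first cancels to \<open>b 3 = a 3\<close>; the
      others contradict \<open>g2\<close>, \<open>g3\<close> and \<open>g1\<close>, in this
      order.\<close>
    show False
      using b4 b34
    proof (elim disjE)
      assume "b 4 = a 4" "a 1 * b 3 * cnj (b 4) = a 1 * a 3 * cnj (a 4)"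
      then show False
        using nz \<open>b 3 \<noteq> a 3\<close> by simp
    next
      assume *: "b 4 = a 4" "a 1 * b 3 * cnj (b 4) = cnj (a 1 * a 3 * cnj (a 4))"
      from cross_multiply1[OF e3[unfolded complex_cnj_mult] *(2)[unfolded *(1) complex_cnj_mult complex_cnj_cnj]]
      have "cnj (a 3) * (a 1 * a 1 * a 2 * cnj (a 4)) = cnj (a 3) * cnj (a 1 * a 1 * a 2 * cnj (a 4))"
        by simp
      then show False
        using g2 nz unfolding Im_eq_zero_iff_cnj by simp
    next
      assume *: "cnj (a 2 * a 2) * b 4 = a 2 * a 2 * cnj (a 4)"
        "a 1 * b 3 * cnj (b 4) = a 1 * a 3 * cnj (a 4)"
      have 4: "a 2 * a 2 * cnj (b 4) = cnj (a 2 * a 2) * a 4"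
        using arg_cong[OF *(1), of cnj] by simp
      have 3: "b 3 * cnj (b 4) = a 3 * cnj (a 4)"
        using *(2) nz by simp
      from cross_multiply2[OF e3[unfolded complex_cnj_mult] 3 4[unfolded complex_cnj_mult]]
      have "a 2 * cnj (a 2) * (a 1 * cnj (a 2) * cnj (a 3) * a 4) =
          a 2 * cnj (a 2) * cnj (a 1 * cnj (a 2) * cnj (a 3) * a 4)"
        by simp
      then show False
        using g3 nz unfolding Im_eq_zero_iff_cnj by simp
    next
      assume *: "cnj (a 2 * a 2) * b 4 = a 2 * a 2 * cnj (a 4)"
        "a 1 * b 3 * cnj (b 4) = cnj (a 1 * a 3 * cnj (a 4))"
      have 4: "a 2 * a 2 * cnj (b 4) = cnj (a 2 * a 2) * a 4"
        using arg_cong[OF *(1), of cnj] by simp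
      from cross_multiply3[OF e3[unfolded complex_cnj_mult] *(2)[unfolded complex_cnj_mult complex_cnj_cnj]
          4[unfolded complex_cnj_mult]]
      have "(a 4 * a 2 * cnj (a 2) * cnj (a 3)) * (a 1 * a 1 * cnj (a 2)) =
          (a 4 * a 2 * cnj (a 2) * cnj (a 3)) * cnj (a 1 * a 1 * cnj (a 2))"
        by simp
      then show False
        using g1 nz unfolding Im_eq_zero_iff_cnj by simp
    qed
  qed
  have step: "b (k + 1) = a (k + 1)" if "k \<ge> 3" and IH: "b k = a k" "b (k - 1) = a (k - 1)" for k
  proof (rule ccontr)
    assume ne: "b (k + 1) \<noteq> a (k + 1)"
    let ?c = "a 1 * a k" and ?d = "a 2 * a (k - 1)"
    \<comment> \<open>By \<open>g4\<close> the real lines spanned by \<open>?c\<close> and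
      \<open>?d\<close> differ, so the reflections of the nonzero \<open>a (k + 1)\<close> in them
      cannot coincide.\<close>
    have cd: "?c * cnj ?d \<noteq> cnj (?c * cnj ?d)"
      using g4[OF \<open>k \<ge> 3\<close>] unfolding Im_eq_zero_iff_cnj by (simp add: mult_ac)
    then have "?c \<noteq> 0" "?d \<noteq> 0"
      by auto
    have "cnj ?c * b (k + 1) = ?c * cnj (a (k + 1))"
      using Re_mult_cnj_eq_cases[of "b (k + 1)" "a (k + 1)" ?c] nrm bis[of 1 k] \<open>?c \<noteq> 0\<close> ne b1 IH that
      by simp
    moreover have "cnj ?d * b (k + 1) = ?d * cnj (a (k + 1))"
      using Re_mult_cnj_eq_cases[of "b (k + 1)" "a (k + 1)" ?d] nrm bis[of 2 "k - 1"] \<open>?d \<noteq> 0\<close> ne b2 IH that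
      by simp
    ultimately have "cnj (a (k + 1)) * (?c * cnj ?d) = cnj (a (k + 1)) * cnj (?c * cnj ?d)"
      unfolding complex_cnj_mult complex_cnj_cnj by (rule cross_multiply4)
    then show False
      using nz'[of "k + 1"] cd that by simp
  qed
  \<comment> \<open>The induction carries two consecutive values because \<open>step\<close> uses
    both. It starts at index 2, which leaves index 1 to \<open>b1\<close>.\<close>
  have "b (k + 2) = a (k + 2) \<and> b (k + 3) = a (k + 3)" for k
  proof (induction k)
    case 0
    then show ?case
      using b2 b3 by (simp add: numeral_2_eq_2)
  next
    case (Suc k)
    then show ?case
      using step[of "k + 3"] by (simp add: numeral_eq_Suc)
  qed
  from this[of "k - 2"] have "k \<noteq> 1 \<Longrightarrow> b k = a k"
    using le_add_diff_inverse2[of 2 k] \<open>k > 0\<close> by simp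
  then show ?thesis
    using b1 by auto
qed

section \<open>Correlation determinants of low order\<close>

lemma det_mat_2: "Determinant.det (Matrix.mat 2 2 f) = f (0, 0) * f (1, 1) - f (0, 1) * (f (1, 0) :: 'a :: comm_ring_1)"
proof -
  have "Determinant.det (Matrix.mat 2 2 f) =
      (\<Sum>i<2. Matrix.mat 2 2 f $$ (i, 0) * cofactor (Matrix.mat 2 2 f) i 0)"
    by (rule laplace_expansion_column) auto
  also have "\<dots> = f (0, 0) * f (1, 1) - f (0, 1) * f (1, 0)"
    by (simp add: numeral_eq_Suc cofactor_def mat_delete_def det_single mult.commute)
  finally show ?thesis .
qed

lemma det_mat_3:
  fixes f :: "nat \<times> nat \<Rightarrow> 'a :: comm_ring_1"
  shows "Determinant.det (Matrix.mat 3 3 f) =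
    f (0, 0) * (f (1, 1) * f (2, 2) - f (1, 2) * f (2, 1)) -
    f (1, 0) * (f (0, 1) * f (2, 2) - f (0, 2) * f (2, 1)) +
    f (2, 0) * (f (0, 1) * f (1, 2) - f (0, 2) * f (1, 1))"
proof -
  have "Determinant.det (Matrix.mat 3 3 f) =
      (\<Sum>i<3. Matrix.mat 3 3 f $$ (i, 0) * cofactor (Matrix.mat 3 3 f) i 0)"
    by (rule laplace_expansion_column) auto
  also have "\<dots> = f (0, 0) * (f (1, 1) * f (2, 2) - f (1, 2) * f (2, 1)) -
    f (1, 0) * (f (0, 1) * f (2, 2) - f (0, 2) * f (2, 1)) +
    f (2, 0) * (f (0, 1) * f (1, 2) - f (0, 2) * f (1, 1))"
    by (simp add: numeral_3_eq_3 cofactor_def mat_delete_def det_mat_2[unfolded numeral_2_eq_2]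
        numeral_2_eq_2 right_diff_distrib)
  finally show ?thesis .
qed

text \<open>The representative is real-valued, so conjugating the integrand affects only the
  character.\<close>

lemma fourier_coeff_uminus: "fourier_coeff f (- k) = cnj (fourier_coeff f k)"
proof -
  have "fourier_coeff f (- k) =
      (LINT x|circle_measure. cnj (complex_of_real (rep_linfty f x) * character (- k) x))"
    unfolding fourier_coeff_character
    by (intro Bochner_Integration.integral_cong refl) (simp add: cnj_character)
  then show ?thesis
    by (simp only: Bochner_Integration.integral_cnj fourier_coeff_character)
qed

lemma determinantal_lawD:
  assumes "determinantal_law f P" "inj_on k {0..<n}"
  shows "Determinant.det (Matrix.mat n n (\<lambda>(i, j). fourier_coeff f (k i - k j))) =
    complex_of_real (measure P {A. \<forall>i<n. k i \<in> A})"
  using assms by (simp add: determinantal_law_def)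

text \<open>These compare the determinants at one, two and three points. The third contains the
  bispectrum product only together with its conjugate, which is why just the real part is
  recovered.\<close>

lemma
  assumes "determinantal_law f P" "determinantal_law g P"
  shows same_law_mean: "fourier_coeff g 0 = fourier_coeff f 0"
    and same_law_norm: "norm (fourier_coeff g k) = norm (fourier_coeff f k)"
    and same_law_bispectrum: "j > 0 \<Longrightarrow> k > 0 \<Longrightarrow>
      Re (fourier_coeff g j * fourier_coeff g k * cnj (fourier_coeff g (j + k))) =
      Re (fourier_coeff f j * fourier_coeff f k * cnj (fourier_coeff f (j + k)))"
proof -
  have det_eq: "Determinant.det (Matrix.mat n n (\<lambda>(i, j). fourier_coeff g (k i - k j))) =
      Determinant.det (Matrix.mat n n (\<lambda>(i, j). fourier_coeff f (k i - k j)))"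
    if "inj_on k {0..<n}" for n and k :: "nat \<Rightarrow> int"
    using determinantal_lawD[OF assms(1) that] determinantal_lawD[OF assms(2) that] by simp
  show mean: "fourier_coeff g 0 = fourier_coeff f 0"
    using det_eq[of id 1] by (simp add: det_single)
  have sq: "(norm (fourier_coeff g k))\<^sup>2 = (norm (fourier_coeff f k))\<^sup>2" for k
  proof (cases "k = 0")
    case True
    then show ?thesis
      using mean by simp
  next
    case False
    then have "inj_on (\<lambda>i. if i = 0 then k else 0) {0..<2::nat}"
      by (auto simp: inj_on_def)
    from det_eq[OF this]
    have "fourier_coeff g k * cnj (fourier_coeff g k) = fourier_coeff f k * cnj (fourier_coeff f k)"
      using mean by (simp add: det_mat_2 fourier_coeff_uminus)
    then show ?thesis
      by (metis complex_norm_square of_real_eq_iff)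
  qed
  then show nrm: "norm (fourier_coeff g k) = norm (fourier_coeff f k)" for k
    by simp
  show "Re (fourier_coeff g j * fourier_coeff g k * cnj (fourier_coeff g (j + k))) =
      Re (fourier_coeff f j * fourier_coeff f k * cnj (fourier_coeff f (j + k)))"
    if jk: "j > 0" "k > 0"
  proof -
    \<comment> \<open>The differences of the points 0, \<open>j\<close>, \<open>j + k\<close> are,
      up to sign, the three indices of the bispectrum; positivity of \<open>j\<close> and
      \<open>k\<close> keeps the points distinct.\<close>
    define p :: "nat \<Rightarrow> int" where "p i = (if i = 0 then 0 else if i = 1 then j else j + k)" for i
    have p: "p 0 = 0" "p 1 = j" "p 2 = j + k" "p (Suc 0) = j"
      by (simp_all add: p_def)
    have "inj_on p {0..<3}"
      using jk by (auto simp: inj_on_def p_def numeral_3_eq_3 less_Suc_eq)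
    note det_eq[OF this]
    moreover have "Determinant.det (Matrix.mat 3 3 (\<lambda>(i, j). fourier_coeff h (p i - p j))) =
        (fourier_coeff h 0) ^ 3 - fourier_coeff h 0 * (of_real ((norm (fourier_coeff h j))\<^sup>2) +
          of_real ((norm (fourier_coeff h k))\<^sup>2) + of_real ((norm (fourier_coeff h (j + k)))\<^sup>2)) +
        (fourier_coeff h j * fourier_coeff h k * cnj (fourier_coeff h (j + k)) +
          cnj (fourier_coeff h j * fourier_coeff h k * cnj (fourier_coeff h (j + k))))" for h
      using fourier_coeff_uminus[of h j] fourier_coeff_uminus[of h k] fourier_coeff_uminus[of h "j + k"]
      by (simp add: det_mat_3 p complex_norm_square algebra_simps power3_eq_cube
          del: minus_add_distrib of_real_power)
    ultimately have "fourier_coeff g j * fourier_coeff g k * cnj (fourier_coeff g (j + k)) +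
        cnj (fourier_coeff g j * fourier_coeff g k * cnj (fourier_coeff g (j + k))) =
      fourier_coeff f j * fourier_coeff f k * cnj (fourier_coeff f (j + k)) +
        cnj (fourier_coeff f j * fourier_coeff f k * cnj (fourier_coeff f (j + k)))"
      using mean nrm by simp
    then show ?thesis
      unfolding complex_add_cnj of_real_eq_iff by simp
  qed
qed


section \<open>Generic functions\<close>

text \<open>The fundamental theorem of calculus on the closed interval; the endpoint 1, absent from
  \<open>circle\<close>, is a null set.\<close>

lemma integral_circle_exp:
  fixes c :: complex
  assumes "c \<noteq> 0"
  shows "(LINT x|circle_measure. exp (c * complex_of_real x)) = (exp c - 1) / c"
proof -
  have "has_bochner_integral lborel (\<lambda>x. indicator {0..1} x *\<^sub>R exp (c * complex_of_real x))
      (exp (c * complex_of_real 1) / c - exp (c * complex_of_real 0) / c)"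
  proof (rule has_bochner_integral_FTC_Icc)
    fix x :: real
    have "((\<lambda>z. exp (c * z) / c) has_field_derivative exp (c * complex_of_real x))
        (at (complex_of_real x) within UNIV)"
      using assms by (auto intro!: derivative_eq_intros)
    then show "((\<lambda>x. exp (c * complex_of_real x) / c) has_vector_derivative
        exp (c * complex_of_real x)) (at x within {0..1})"
      by (intro has_vector_derivative_real_field)
  qed (auto intro!: continuous_intros)
  then have "(LINT x|lborel. indicator {0..1} x *\<^sub>R exp (c * complex_of_real x)) = (exp c - 1) / c"
    by (simp add: has_bochner_integral_integral_eq diff_divide_distrib)
  moreover have "(LINT x|circle_measure. exp (c * complex_of_real x)) =
      (LINT x|lborel. indicator {0..<1} x *\<^sub>R exp (c * complex_of_real x))"
    unfolding circle_measure_def circle_def by (subst integral_restrict_space) auto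
  moreover have "\<dots> = (LINT x|lborel. indicator {0..1} x *\<^sub>R exp (c * complex_of_real x))"
  proof (rule integral_cong_AE)
    have "AE x in lborel. x \<noteq> (1 :: real)"
      by (rule AE_lborel_singleton)
    then show "AE x in lborel. indicator {0..<1} x *\<^sub>R exp (c * complex_of_real x) =
        indicator {0..1} x *\<^sub>R exp (c * complex_of_real x)"
      by eventually_elim (auto simp: indicator_def)
  qed measurable
  ultimately show ?thesis
    by simp
qed

lemma integrable_fourier:
  assumes "ess_bounded h"
  shows "integrable circle_measure (\<lambda>x. complex_of_real (h x) * character k x)"
proof -
  interpret prob_space circle_measure
    by (rule prob_space_circle_measure)
  obtain C where "AE x in circle_measure. \<bar>h x\<bar> \<le> C"
    using assms by (auto simp: ess_bounded_def)
  then show ?thesis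
    using ess_bounded_measurable[OF assms] measurable_circle_borel[OF refl character_measurable]
    by (intro integrable_const_bound[of _ C]) (auto simp: norm_mult)
qed

text \<open>Representatives add and scale only almost everywhere, which integrals do not see. The
  bound 1 is the total mass of the circle.\<close>

lemma bounded_linear_fourier_coeff: "bounded_linear (\<lambda>f. fourier_coeff f k)"
proof (rule bounded_linear_intro[where K = 1])
  interpret prob_space circle_measure
    by (rule prob_space_circle_measure)
  have int: "integrable circle_measure (\<lambda>x. complex_of_real (rep_linfty h x) * character (- k) x)" for h
    by (rule integrable_fourier[OF ess_bounded_rep_linfty])
  have meas: "(\<lambda>x. complex_of_real (rep_linfty h x) * character (- k) x)
      \<in> borel_measurable circle_measure" for h
    using int by (rule borel_measurable_integrable)
  show "fourier_coeff (f + g) k = fourier_coeff f k + fourier_coeff g k" for f g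
    unfolding fourier_coeff_character Bochner_Integration.integral_add[OF int int, symmetric]
    by (rule integral_cong_AE[OF meas borel_measurable_add[OF meas meas]],
        use rep_plus[of f g] in eventually_elim) (simp add: distrib_right)
  show "fourier_coeff (r *\<^sub>R f) k = r *\<^sub>R fourier_coeff f k" for r f
    unfolding fourier_coeff_character integral_scaleR_right[symmetric]
    by (rule integral_cong_AE[OF meas borel_measurable_scaleR[OF borel_measurable_const meas]],
        use rep_scaleR[of r f] in eventually_elim) (simp add: scaleR_conv_of_real)
  show "norm (fourier_coeff f k) \<le> norm f * 1" for f
  proof -
    have "norm (fourier_coeff f k) \<le>
        (LINT x|circle_measure. norm (complex_of_real (rep_linfty f x) * character (- k) x))"
      unfolding fourier_coeff_character by (rule integral_norm_bound)
    also have "\<dots> \<le> (LINT x|circle_measure. norm f)"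
      by (rule integral_mono_AE[OF integrable_norm[OF int]],
          simp, use AE_le_norm_linfty[of f] in eventually_elim) (simp add: norm_mult)
    finally show ?thesis
      using prob_space by simp
  qed
qed

section \<open>The reference function\<close>

definition decay :: linfty
  where "decay = abs_linfty (\<lambda>x. exp (- x))"

lemma rep_decay: "AE x in circle_measure. rep_linfty decay x = exp (- x)"
  unfolding decay_def
proof (intro rep_abs_linfty ess_boundedI)
  show "(\<lambda>x. exp (- x)) \<in> borel_measurable circle_measure"
    by (intro measurable_circle_borel[OF refl]) measurable
  show "AE x in circle_measure. \<bar>exp (- x)\<bar> \<le> 1"
    by (auto simp: circle_def)
qed

lemma decay_unit: "decay \<in> unit_functions"
  unfolding unit_functions_def mem_Collect_eq
  using rep_decay AE_space by eventually_elim (auto simp: circle_def)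

text \<open>The integrand is a single exponential. Since characters equal 1 at the endpoint 1, only
  the factor \<open>exp (- 1)\<close> remains there.\<close>

lemma fourier_coeff_decay:
  "fourier_coeff decay k = complex_of_real (1 - exp (- 1)) / (1 + \<i> * complex_of_real (2 * pi * of_int k))"
proof -
  define c where "c = - (1 + \<i> * complex_of_real (2 * pi * of_int k))"
  have "Re c = - 1"
    by (simp add: c_def)
  then have "c \<noteq> 0"
    by auto
  have "fourier_coeff decay k = (LINT x|circle_measure. exp (c * complex_of_real x))"
    unfolding fourier_coeff_character
  proof (rule integral_cong_AE)
    show "(\<lambda>x. complex_of_real (rep_linfty decay x) * character (- k) x) \<in> borel_measurable circle_measure"
      by (intro borel_measurable_integrable integrable_fourier ess_bounded_rep_linfty)
    show "(\<lambda>x. exp (c * complex_of_real x)) \<in> borel_measurable circle_measure"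
      by (intro measurable_circle_borel[OF refl]) measurable
    show "AE x in circle_measure. complex_of_real (rep_linfty decay x) * character (- k) x =
        exp (c * complex_of_real x)"
      using rep_decay
    proof eventually_elim
      case (elim x)
      have "c * complex_of_real x =
          complex_of_real (- x) + \<i> * complex_of_real (2 * pi * of_int (- k) * x)"
        by (simp add: c_def algebra_simps)
      then show ?case
        unfolding elim character_def cis_conv_exp exp_of_real[symmetric] by (simp only: exp_add)
    qed
  qed
  also have "\<dots> = (exp c - 1) / c"
    using \<open>c \<noteq> 0\<close> by (rule integral_circle_exp)
  also have "exp c = complex_of_real (exp (- 1)) * character (- k) 1"
  proof -
    have "c = complex_of_real (- 1) + \<i> * complex_of_real (2 * pi * of_int (- k) * 1)"
      by (simp add: c_def)
    then show ?thesis
      unfolding character_def cis_conv_exp exp_of_real[symmetric] by (simp only: exp_add)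
  qed
  also have "character (- k) 1 = 1"
    unfolding character_def using cis_multiple_2pi[of "of_int (- k)"] by simp
  also have "complex_of_real (exp (- 1)) * 1 - 1 = - complex_of_real (1 - exp (- 1))"
    by simp
  also have "- complex_of_real (1 - exp (- 1)) / c =
      complex_of_real (1 - exp (- 1)) / (1 + \<i> * complex_of_real (2 * pi * of_int k))"
    unfolding c_def by (rule minus_divide_divide)
  finally show ?thesis .
qed

text \<open>Conjugate factors enter as negated indices, by \<open>fourier_coeff_uminus\<close>.
  Integer lists form a countable type, which makes the exceptional set a countable union.\<close>

definition coeff_product :: "linfty \<Rightarrow> int list \<Rightarrow> complex"
  where "coeff_product f ks = prod_list (map (fourier_coeff f) ks)"

lemma continuous_coeff_product: "continuous_on UNIV (\<lambda>f. coeff_product f ks)"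
proof (induction ks)
  case Nil
  then show ?case
    by (simp add: coeff_product_def)
next
  case (Cons k ks)
  have "continuous_on UNIV (\<lambda>f. fourier_coeff f k)"
    using bounded_linear_fourier_coeff by (rule linear_continuous_on)
  then show ?case
    using Cons by (simp add: coeff_product_def continuous_on_mult)
qed

text \<open>Each factor is affine in \<open>t\<close>. Splitting into two real polynomials lets the
  imaginary part be handled by counting real roots.\<close>

lemma coeff_product_segment:
  "\<exists>p q. \<forall>t. coeff_product ((1 - t) *\<^sub>R f + t *\<^sub>R g) ks = Complex (poly p t) (poly q t)"
proof (induction ks)
  case Nil
  have "coeff_product ((1 - t) *\<^sub>R f + t *\<^sub>R g) [] = Complex (poly 1 t) (poly 0 t)" for t
    by (simp add: coeff_product_def complex_eq_iff)
  then show ?case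
    by blast
next
  case (Cons k ks)
  then obtain p q where pq:
    "\<And>t. coeff_product ((1 - t) *\<^sub>R f + t *\<^sub>R g) ks = Complex (poly p t) (poly q t)"
    by blast
  interpret bounded_linear "\<lambda>f. fourier_coeff f k"
    by (rule bounded_linear_fourier_coeff)
  define a b where "a = fourier_coeff f k" and "b = fourier_coeff g k"
  define u v where "u = [:Re a, Re (b - a):]" and "v = [:Im a, Im (b - a):]"
  have "fourier_coeff ((1 - t) *\<^sub>R f + t *\<^sub>R g) k = Complex (poly u t) (poly v t)" for t
  proof -
    have "fourier_coeff ((1 - t) *\<^sub>R f + t *\<^sub>R g) k = (1 - t) *\<^sub>R a + t *\<^sub>R b"
      by (simp only: add scaleR a_def b_def)
    then show ?thesis
      by (simp add: complex_eq_iff u_def v_def algebra_simps)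
  qed
  then have "coeff_product ((1 - t) *\<^sub>R f + t *\<^sub>R g) (k # ks) =
      Complex (poly (u * p - v * q) t) (poly (u * q + v * p) t)" for t
    using pq[of t] by (simp add: coeff_product_def complex_eq_iff)
  then show ?case
    by blast
qed

lemma unit_functions_segment:
  assumes "f \<in> unit_functions" "g \<in> unit_functions" "0 \<le> t" "t \<le> 1"
  shows "(1 - t) *\<^sub>R f + t *\<^sub>R g \<in> unit_functions"
proof -
  have "AE x in circle_measure. 0 \<le> rep_linfty f x \<and> rep_linfty f x \<le> 1"
    "AE x in circle_measure. 0 \<le> rep_linfty g x \<and> rep_linfty g x \<le> 1"
    using assms by (auto simp: unit_functions_def)
  then have "AE x in circle_measure. 0 \<le> rep_linfty ((1 - t) *\<^sub>R f + t *\<^sub>R g) x \<and>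
      rep_linfty ((1 - t) *\<^sub>R f + t *\<^sub>R g) x \<le> 1"
    using rep_plus[of "(1 - t) *\<^sub>R f" "t *\<^sub>R g"] rep_scaleR[of "1 - t" f] rep_scaleR[of t g]
  proof eventually_elim
    case (elim x)
    have "(1 - t) * rep_linfty f x + t * rep_linfty g x \<le> 1"
      by (rule convex_bound_le) (use elim assms in auto)
    then show ?case
      using elim assms by simp
  qed
  then show ?thesis
    by (simp add: unit_functions_def)
qed

text \<open>The set is closed by continuity. Were \<open>f\<close> an interior point, the imaginary
  part would vanish along an initial piece of the segment from \<open>f\<close> to \<open>p\<close>;
  being polynomial, it would vanish at \<open>p\<close> as well.\<close>

lemma nowhere_dense_real_coeff_product:
  assumes p: "p \<in> unit_functions" "Im (coeff_product p ks) \<noteq> 0"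
  shows "nowhere_dense_in (top_of_set unit_functions)
    {f \<in> unit_functions. Im (coeff_product f ks) = 0}"
proof -
  let ?X = "top_of_set unit_functions" and ?S = "{f \<in> unit_functions. Im (coeff_product f ks) = 0}"
  have "closed {f. Im (coeff_product f ks) = 0}"
    by (intro closed_Collect_eq continuous_intros continuous_coeff_product)
  then have "closedin ?X ?S"
    by (auto simp: closedin_closed Collect_conj_eq Int_commute)
  then have cl: "?X closure_of ?S = ?S"
    by (simp add: closure_of_closedin)
  have "f \<notin> ?X interior_of ?S" for f
  proof
    assume "f \<in> ?X interior_of ?S"
    then obtain T where T: "openin ?X T" "f \<in> T" "T \<subseteq> ?S"
      by (auto simp: interior_of_def)
    then obtain U where U: "open U" "T = unit_functions \<inter> U"
      by (auto simp: openin_open)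
    have f: "f \<in> unit_functions" "f \<in> U"
      using T U by auto
    define path where "path t = (1 - t) *\<^sub>R f + t *\<^sub>R p" for t :: real
    obtain q r where qr: "\<And>t. coeff_product (path t) ks = Complex (poly q t) (poly r t)"
      using coeff_product_segment[of f p ks] unfolding path_def by blast
    have "path 1 = p"
      by (simp add: path_def)
    then have "poly r 1 \<noteq> 0"
      using qr[of 1] p by simp
    then have "r \<noteq> 0"
      by auto
    then have fin: "finite {t. poly r t = 0}"
      by (rule poly_roots_finite)
    have "open (path -` U)"
      unfolding path_def by (intro open_vimage U continuous_intros)
    moreover have "0 \<in> path -` U"
      using f by (simp add: path_def)
    ultimately obtain d where d: "d > 0" "\<And>t. dist t 0 < d \<Longrightarrow> path t \<in> U"
      unfolding open_dist by blast
    \<comment> \<open>Bounding \<open>t\<close> by \<open>d\<close> keeps the path in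
      \<open>U\<close>, bounding it by 1 keeps it in \<open>unit_functions\<close> by
      convexity.\<close>
    have "{0<..<min d 1} \<subseteq> {t. poly r t = 0}"
    proof
      fix t :: real
      assume t: "t \<in> {0<..<min d 1}"
      then have "path t \<in> unit_functions \<inter> U"
        using d f p unit_functions_segment[of f p t] by (auto simp: path_def)
      then have "Im (coeff_product (path t) ks) = 0"
        using T U by auto
      then show "t \<in> {t. poly r t = 0}"
        by (simp add: qr)
    qed
    then have "finite {0<..<min d 1}"
      using fin finite_subset by blast
    then show False
      using d infinite_Ioo[of 0 "min d 1"] by auto
  qed
  then show ?thesis
    unfolding nowhere_dense_in_def cl by auto
qed

lemma coeff_product_decay:
  "coeff_product decay ks = complex_of_real ((1 - exp (- 1)) ^ length ks) /
    prod_list (map (\<lambda>k. Complex 1 (2 * pi * of_int k)) ks)"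
proof (induction ks)
  case Nil
  then show ?case
    by (simp add: coeff_product_def)
next
  case (Cons k ks)
  have "1 + \<i> * complex_of_real (2 * pi * of_int k) = Complex 1 (2 * pi * of_int k)"
    by (simp add: complex_eq_iff)
  then show ?case
    using Cons by (simp add: coeff_product_def fourier_coeff_decay)
qed

text \<open>A nonzero real multiple of the reciprocal of a non-real number is non-real.\<close>

lemma Im_coeff_product_decay_nonzero:
  assumes "Im (prod_list (map (\<lambda>k. Complex 1 (2 * pi * of_int k)) ks)) \<noteq> 0"
  shows "Im (coeff_product decay ks) \<noteq> 0"
proof -
  define w where "w = prod_list (map (\<lambda>k. Complex 1 (2 * pi * of_int k)) ks)"
  have "Im w \<noteq> 0"
    using assms by (simp add: w_def)
  then have "Re w ^ 2 + Im w ^ 2 > 0"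
    by (simp add: sum_power2_gt_zero_iff)
  moreover have "(1 - exp (- 1 :: real)) ^ length ks \<noteq> 0"
    by simp
  ultimately show ?thesis
    using \<open>Im w \<noteq> 0\<close> unfolding coeff_product_decay w_def[symmetric] by (simp add: Im_divide)
qed

text \<open>Restricting to lists that are non-real at \<open>decay\<close> supplies the witness by
  which each exceptional set is nowhere dense.\<close>

definition generic :: "linfty \<Rightarrow> bool"
  where "generic f \<longleftrightarrow> (\<forall>ks. Im (coeff_product decay ks) \<noteq> 0 \<longrightarrow> Im (coeff_product f ks) \<noteq> 0)"

lemma meagre_not_generic:
  "meagre_in (top_of_set unit_functions) {f \<in> unit_functions. \<not> generic f}"
  unfolding meagre_in_def
proof (intro exI conjI)
  let ?N = "(\<lambda>ks. {f \<in> unit_functions. Im (coeff_product f ks) = 0}) `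
    {ks. Im (coeff_product decay ks) \<noteq> 0}"
  show "countable ?N"
    by simp
  show "\<forall>N\<in>?N. nowhere_dense_in (top_of_set unit_functions) N"
    using nowhere_dense_real_coeff_product decay_unit by auto
  show "{f \<in> unit_functions. \<not> generic f} = \<Union> ?N"
    by (auto simp: generic_def)
qed

text \<open>With \<open>w = 2 * pi\<close>, the product of the numbers
  \<open>Complex 1 (w * k)\<close> over at most four indices has imaginary part \<open>w\<close>
  times the sum of the indices minus \<open>w ^ 3\<close> times their third elementary symmetric
  sum. The lists have sum 0, so only the cubic term survives, and its coefficient is
  nonzero.\<close>

lemma generic_Im_nonzero:
  assumes "generic f"
  shows "Im (coeff_product f [1, 1, -2]) \<noteq> 0"
    and "Im (coeff_product f [1, 1, 2, -4]) \<noteq> 0"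
    and "Im (coeff_product f [1, -2, -3, 4]) \<noteq> 0"
    and "k \<ge> 3 \<Longrightarrow> Im (coeff_product f [1, k, -2, 1 - k]) \<noteq> 0"
proof -
  have *: "Im (coeff_product f ks) \<noteq> 0"
    if "Im (prod_list (map (\<lambda>k. Complex 1 (2 * pi * of_int k)) ks)) \<noteq> 0" for ks
    using assms Im_coeff_product_decay_nonzero[OF that] by (simp add: generic_def)
  define w where "w = 2 * pi"
  have w: "w ^ 3 \<noteq> 0"
    by (simp add: w_def)
  have "Im (prod_list (map (\<lambda>k. Complex 1 (w * of_int k)) [1, 1, -2])) = 2 * w ^ 3"
    by (simp add: algebra_simps power3_eq_cube)
  with w show "Im (coeff_product f [1, 1, -2]) \<noteq> 0"
    by (intro *) (simp add: w_def)
  have "Im (prod_list (map (\<lambda>k. Complex 1 (w * of_int k)) [1, 1, 2, -4])) = 18 * w ^ 3"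
    by (simp add: algebra_simps power3_eq_cube)
  with w show "Im (coeff_product f [1, 1, 2, -4]) \<noteq> 0"
    by (intro *) (simp add: w_def)
  have "Im (prod_list (map (\<lambda>k. Complex 1 (w * of_int k)) [1, -2, -3, 4])) = - 10 * w ^ 3"
    by (simp add: algebra_simps power3_eq_cube)
  with w show "Im (coeff_product f [1, -2, -3, 4]) \<noteq> 0"
    by (intro *) (simp add: w_def)
  assume "k \<ge> 3"
  have "Im (prod_list (map (\<lambda>k. Complex 1 (w * of_int k)) [1, k, -2, 1 - k])) =
      of_int ((k + 1) * (2 - k)) * w ^ 3"
    by (simp add: algebra_simps power3_eq_cube)
  moreover have "(k + 1) * (2 - k) \<noteq> 0"
    using \<open>k \<ge> 3\<close> by simp
  ultimately show "Im (coeff_product f [1, k, -2, 1 - k]) \<noteq> 0"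
    using w by (intro *) (simp only: w_def mult_eq_0_iff of_int_eq_0_iff simp_thms)
qed


section \<open>Rigid motions of the circle\<close>

text \<open>Nonnegative bounded functions are densities of finite measures, so uniqueness for
  measures applies, and densities are unique almost everywhere.\<close>

lemma bounded_nonneg_eqI_fourier:
  fixes u v :: "real \<Rightarrow> real"
  assumes u: "u \<in> borel_measurable circle_measure" "AE x in circle_measure. 0 \<le> u x \<and> u x \<le> C"
    and v: "v \<in> borel_measurable circle_measure" "AE x in circle_measure. 0 \<le> v x \<and> v x \<le> C"
    and eq: "\<And>k. (LINT x|circle_measure. complex_of_real (u x) * character k x) =
      (LINT x|circle_measure. complex_of_real (v x) * character k x)"
  shows "AE x in circle_measure. u x = v x"
proof -
  interpret prob_space circle_measure
    by (rule prob_space_circle_measure)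
  have fin: "finite_measure (density circle_measure (\<lambda>x. ennreal (h x)))"
    if "h \<in> borel_measurable circle_measure" "AE x in circle_measure. 0 \<le> h x \<and> h x \<le> C" for h
  proof (rule finite_measureI)
    have "(\<integral>\<^sup>+ x. ennreal (h x) * indicator circle x \<partial>circle_measure) \<le>
        (\<integral>\<^sup>+ x. ennreal C \<partial>circle_measure)"
      by (intro nn_integral_mono_AE, use that(2) in eventually_elim)
        (auto simp: indicator_def intro: ennreal_leI)
    also have "\<dots> < \<infinity>"
      using emeasure_space_1 by simp
    finally show "emeasure (density circle_measure (\<lambda>x. ennreal (h x)))
        (space (density circle_measure (\<lambda>x. ennreal (h x)))) \<noteq> \<infinity>"
      using that sets.top[of circle_measure] by (simp add: emeasure_density)
  qed
  have chr: "(LINT x|density circle_measure (\<lambda>x. ennreal (h x)). character k x) =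
      (LINT x|circle_measure. complex_of_real (h x) * character k x)"
    if "h \<in> borel_measurable circle_measure" "AE x in circle_measure. 0 \<le> h x \<and> h x \<le> C" for h k
    using that measurable_circle_borel[OF refl character_measurable]
    by (subst integral_density) (auto simp: scaleR_conv_of_real)
  have "density circle_measure (\<lambda>x. ennreal (u x)) = density circle_measure (\<lambda>x. ennreal (v x))"
    by (rule circle_measure_eqI_character) (simp_all add: fin[OF u] fin[OF v] chr[OF u] chr[OF v] eq)
  then have "AE x in circle_measure. ennreal (u x) = ennreal (v x)"
    using u(1) v(1) density_unique_iff by simp
  then show ?thesis
    using u(2) v(2) by eventually_elim simp
qed

section \<open>Characters under translation and flip\<close>

lemma character_of_int: "character k (of_int n) = 1"
  unfolding character_def using cis_multiple_2pi[of "of_int (k * n)"] by (simp add: mult_ac)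

lemma character_add_right: "character k (x + y) = character k x * character k y"
  by (simp add: character_def cis_mult algebra_simps)

lemma character_frac: "character k (frac x) = character k x"
proof -
  have "character k x = character k (frac x + of_int \<lfloor>x\<rfloor>)"
    by (simp add: frac_def)
  then show ?thesis
    by (simp only: character_add_right character_of_int mult_1_right)
qed

lemma character_mult: "character (k * j) x = character k (of_int j * x)"
  by (simp add: character_def mult_ac)

lemma integral_character: "(LINT x|circle_measure. character k x) = (if k = 0 then 1 else 0)"
proof (cases "k = 0")
  case True
  interpret prob_space circle_measure
    by (rule prob_space_circle_measure)
  show ?thesis
    using True prob_space by simp
next
  case False
  define c where "c = \<i> * complex_of_real (2 * pi * of_int k)"
  have "c \<noteq> 0"
    using False by (simp add: c_def)
  have "exp c = 1"
    using character_of_int[of k 1] unfolding character_def cis_conv_exp by (simp add: c_def)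
  have "character k x = exp (c * complex_of_real x)" for x
    by (simp add: character_def cis_conv_exp c_def mult_ac)
  then show ?thesis
    using integral_circle_exp[OF \<open>c \<noteq> 0\<close>] \<open>exp c = 1\<close> False by simp
qed

text \<open>Used with \<open>s = 1\<close> for a translation and \<open>s = - 1\<close> for a flip
  followed by a translation; \<open>frac\<close> returns to the representatives in
  \<open>circle\<close>.\<close>

definition rigid :: "int \<Rightarrow> real \<Rightarrow> real \<Rightarrow> real"
  where "rigid s \<xi> x = frac (of_int s * x + \<xi>)"

lemma rigid_measurable: "rigid s \<xi> \<in> measurable circle_measure circle_measure"
proof -
  have "rigid s \<xi> \<in> borel_measurable borel"
    unfolding rigid_def frac_def by measurable
  then have "rigid s \<xi> \<in> borel_measurable circle_measure"
    by (rule measurable_circle_borel[OF refl])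
  then show ?thesis
    unfolding circle_measure_def
    by (intro measurable_restrict_space2) (auto simp: rigid_def circle_def frac_lt_1)
qed

lemma character_rigid: "character k (rigid s \<xi> x) = character k \<xi> * character (k * s) x"
  by (simp add: rigid_def character_frac character_add_right character_mult)

text \<open>By Fourier uniqueness it suffices to test characters. Each is pulled back to a multiple
  of a character, trivial exactly when the original is, and nontrivial characters have integral
  0.\<close>

lemma distr_rigid:
  assumes "\<bar>s\<bar> = 1"
  shows "distr circle_measure circle_measure (rigid s \<xi>) = circle_measure"
proof (rule circle_measure_eqI_character)
  interpret prob_space circle_measure
    by (rule prob_space_circle_measure)
  show "finite_measure (distr circle_measure circle_measure (rigid s \<xi>))"
    by (intro finite_measure_distr rigid_measurable)
  show "finite_measure circle_measure"
    by (rule finite_measure_axioms)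
  fix k
  have "(LINT x|distr circle_measure circle_measure (rigid s \<xi>). character k x) =
      (LINT x|circle_measure. character k \<xi> * character (k * s) x)"
    using measurable_circle_borel[OF refl character_measurable]
    by (subst integral_distr[OF rigid_measurable]) (simp_all add: character_rigid)
  also have "\<dots> = (LINT x|circle_measure. character k x)"
    using assms by (auto simp: integral_character)
  finally show "(LINT x|distr circle_measure circle_measure (rigid s \<xi>). character k x) =
      (LINT x|circle_measure. character k x)" .
qed auto

text \<open>A change of variables by the measure-preserving \<open>rigid s \<xi>\<close>. As
  \<open>s * s = 1\<close>, the character \<open>- k\<close> is a constant times the pullback of the
  character \<open>- (s * k)\<close>.\<close>

lemma fourier_rigid:
  assumes "\<bar>s\<bar> = 1"
  shows "(LINT x|circle_measure. complex_of_real (rep_linfty f (rigid s \<xi> x)) * character (- k) x) =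
    character (s * k) \<xi> * fourier_coeff f (s * k)"
proof -
  have s: "s * s = 1"
    using assms by (auto simp: abs_if split: if_splits)
  have meas: "(\<lambda>y. complex_of_real (rep_linfty f y) * character (- (s * k)) y)
      \<in> borel_measurable circle_measure"
    by (intro borel_measurable_integrable integrable_fourier ess_bounded_rep_linfty)
  have chr: "character (- k) x = character (s * k) \<xi> * character (- (s * k)) (rigid s \<xi> x)" for x
  proof -
    have 1: "character (s * k) \<xi> * character (- (s * k)) \<xi> = 1"
      unfolding character_add[symmetric] by simp
    have 2: "- (s * k) * s = - k"
      using s by (metis mult.assoc mult.commute mult_1_right mult_minus_left)
    show ?thesis
      unfolding character_rigid 2 mult.assoc[symmetric] 1 by simp
  qed
  have "fourier_coeff f (s * k) = (LINT y|distr circle_measure circle_measure (rigid s \<xi>).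
      complex_of_real (rep_linfty f y) * character (- (s * k)) y)"
    unfolding distr_rigid[OF assms] by (rule fourier_coeff_character)
  also have "\<dots> = (LINT x|circle_measure.
      complex_of_real (rep_linfty f (rigid s \<xi> x)) * character (- (s * k)) (rigid s \<xi> x))"
    by (rule integral_distr[OF rigid_measurable meas])
  finally have "character (s * k) \<xi> * fourier_coeff f (s * k) = (LINT x|circle_measure.
      character (s * k) \<xi> * (complex_of_real (rep_linfty f (rigid s \<xi> x)) * character (- (s * k)) (rigid s \<xi> x)))"
    by simp
  also have "\<dots> = (LINT x|circle_measure. complex_of_real (rep_linfty f (rigid s \<xi> x)) * character (- k) x)"
    by (intro Bochner_Integration.integral_cong refl) (simp add: chr)
  finally show ?thesis ..
qed

lemma eq_rigid_of_fourier_coeff: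
  assumes fg: "f \<in> unit_functions" "g \<in> unit_functions" and s: "\<bar>s\<bar> = 1"
    and eq: "\<And>k. fourier_coeff g k = character (s * k) \<xi> * fourier_coeff f (s * k)"
  shows "AE x in circle_measure. rep_linfty g x = rep_linfty f (rigid s \<xi> x)"
proof (rule bounded_nonneg_eqI_fourier[where C = 1])
  show "rep_linfty g \<in> borel_measurable circle_measure"
    by (intro ess_bounded_measurable ess_bounded_rep_linfty)
  show "(\<lambda>x. rep_linfty f (rigid s \<xi> x)) \<in> borel_measurable circle_measure"
    by (intro measurable_compose[OF rigid_measurable] ess_bounded_measurable ess_bounded_rep_linfty)
  show "AE x in circle_measure. 0 \<le> rep_linfty g x \<and> rep_linfty g x \<le> 1"
    using fg by (simp add: unit_functions_def)
  \<comment> \<open>The bounds on \<open>f\<close> pass to its composition with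
    \<open>rigid s \<xi>\<close> because the motion preserves the measure.\<close>
  have "AE y in distr circle_measure circle_measure (rigid s \<xi>). 0 \<le> rep_linfty f y \<and> rep_linfty f y \<le> 1"
    unfolding distr_rigid[OF s] using fg by (simp add: unit_functions_def)
  then show "AE x in circle_measure. 0 \<le> rep_linfty f (rigid s \<xi> x) \<and> rep_linfty f (rigid s \<xi> x) \<le> 1"
    by (rule AE_distrD[OF rigid_measurable])
  show "(LINT x|circle_measure. complex_of_real (rep_linfty g x) * character k x) =
      (LINT x|circle_measure. complex_of_real (rep_linfty f (rigid s \<xi> x)) * character k x)" for k
    using eq[of "- k"] fourier_rigid[OF s, of f \<xi> "- k"] fourier_coeff_character[of g "- k"] by simp
qed

section \<open>Finding the rigid motion\<close>

lemma character_surj: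
  assumes "norm w = 1" "\<bar>s\<bar> = 1"
  obtains \<xi> where "\<xi> \<in> circle" "character s \<xi> = w"
proof
  define \<theta> where "\<theta> = of_int s * Arg w / (2 * pi)"
  have "s * s = 1"
    using assms(2) by (auto simp: abs_if split: if_splits)
  then have s: "real_of_int s * real_of_int s = 1"
    by (metis of_int_1 of_int_mult)
  show "frac \<theta> \<in> circle"
    by (simp add: circle_def frac_lt_1)
  have "character s (frac \<theta>) = cis (of_int s * of_int s * Arg w)"
    unfolding character_frac by (simp add: character_def \<theta>_def mult_ac)
  also have "\<dots> = w"
  proof -
    have "w \<noteq> 0"
      using assms(1) by auto
    then show ?thesis
      using assms(1) cis_Arg[of w] by (simp add: s sgn_eq)
  qed
  finally show "character s (frac \<theta>) = w" .
qed

text \<open>The translation factors multiply to the character of the index sum, which is trivial;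
  the flip negates all indices and so conjugates the product.\<close>

lemma prod_list_rigid:
  assumes "\<bar>s\<bar> = 1" "sum_list ks = 0"
    and a: "\<And>k. a k = character (s * k) \<xi> * fourier_coeff f (s * k)"
  shows "prod_list (map a ks) = coeff_product f ks \<or> prod_list (map a ks) = cnj (coeff_product f ks)"
proof -
  have "prod_list (map a ks) = character (s * sum_list ks) \<xi> * coeff_product f (map ((*) s) ks)" for ks
    by (induction ks) (simp_all add: a coeff_product_def distrib_left character_add)
  moreover have "coeff_product f (map uminus ks) = cnj (coeff_product f ks)" for ks
    by (induction ks) (simp_all add: coeff_product_def fourier_coeff_uminus)
  moreover have "s = 1 \<or> s = - 1"
    using assms(1) by linarith
  moreover have "map ((*) 1) ks = ks" "map ((*) (- 1)) ks = map uminus ks"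
    by (simp_all add: map_idI)
  ultimately show ?thesis
    using assms(2) by (metis character_zero mult_1_left mult_zero_right)
qed

text \<open>The motion is read off two coefficients: the bispectrum at \<open>1 + 1\<close> fixes
  the orientation \<open>s\<close> and the coefficient at 1 fixes the translation
  \<open>\<xi>\<close>. The moved coefficients \<open>a\<close> of \<open>f\<close> are then
  compared with those of \<open>g\<close>.\<close>

lemma generic_determined:
  assumes gen: "generic f" and P: "determinantal_law f P" "determinantal_law g P"
  obtains s \<xi> where "\<bar>s\<bar> = 1" "\<xi> \<in> circle"
    "\<And>k. fourier_coeff g k = character (s * k) \<xi> * fourier_coeff f (s * k)"
proof -
  define F G where "F = fourier_coeff f" and "G = fourier_coeff g"
  have nrm: "norm (G k) = norm (F k)" for k
    unfolding F_def G_def by (rule same_law_norm[OF P])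
  have bis: "Re (G j * G k * cnj (G (j + k))) = Re (F j * F k * cnj (F (j + k)))"
    if "j > 0" "k > 0" for j k
    unfolding F_def G_def using that by (rule same_law_bispectrum[OF P])
  have cnjF: "F (- k) = cnj (F k)" "G (- k) = cnj (G k)" for k
    unfolding F_def G_def by (rule fourier_coeff_uminus)+
  have F1: "F 1 \<noteq> 0"
    using generic_Im_nonzero(1)[OF gen] by (auto simp: coeff_product_def F_def)
  have "norm (G 1 * G 1 * cnj (G 2)) = norm (F 1 * F 1 * cnj (F 2))"
    using nrm by (simp add: norm_mult)
  then have "G 1 * G 1 * cnj (G 2) = F 1 * F 1 * cnj (F 2) \<or>
      G 1 * G 1 * cnj (G 2) = cnj (F 1 * F 1 * cnj (F 2))"
    using bis[of 1 1] by (intro complex_Re_norm_eq_cases) auto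
  \<comment> \<open>If the bispectrum value is the conjugate one, the flip turns it into that of
    \<open>f\<close>.\<close>
  then obtain s where s: "\<bar>s\<bar> = 1" "G 1 * G 1 * cnj (G 2) = F s * F s * cnj (F (s * 2))"
  proof
    assume "G 1 * G 1 * cnj (G 2) = F 1 * F 1 * cnj (F 2)"
    then show ?thesis
      by (intro that[of 1]) auto
  next
    assume "G 1 * G 1 * cnj (G 2) = cnj (F 1 * F 1 * cnj (F 2))"
    then show ?thesis
      using cnjF[of 1] cnjF[of 2] by (intro that[of "- 1"]) auto
  qed
  have Fs: "norm (F s) = norm (F 1)"
    using s(1) cnjF[of 1] by (cases "s = 1") (auto simp: abs_if split: if_splits)
  have "norm (G 1 / F s) = 1"
    using nrm Fs F1 by (simp add: norm_divide)
  \<comment> \<open>This translation makes the first coefficients agree, see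
    \<open>G1\<close>.\<close>
  then obtain \<xi> where \<xi>: "\<xi> \<in> circle" "character s \<xi> = G 1 / F s"
    using character_surj s(1) by metis
  define a where "a k = character (s * k) \<xi> * F (s * k)" for k
  have prod: "prod_list (map a ks) = coeff_product f ks \<or> prod_list (map a ks) = cnj (coeff_product f ks)"
    if "sum_list ks = 0" for ks
    using s(1) that by (rule prod_list_rigid[where \<xi> = \<xi>]) (simp add: a_def F_def)
  \<comment> \<open>Genericity of \<open>f\<close> passes to \<open>a\<close>, since conjugation
    does not make a non-real number real.\<close>
  have Im_prod: "Im (prod_list (map a ks)) \<noteq> 0"
    if "Im (coeff_product f ks) \<noteq> 0" "sum_list ks = 0" for ks
    using prod[OF that(2)] that(1) by auto
  have a_uminus: "a (- k) = cnj (a k)" for k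
    using cnjF[of "s * k"] by (simp add: a_def cnj_character)
  have G1: "G 1 = a 1"
    using \<xi> F1 Fs by (auto simp: a_def)
  \<comment> \<open>Translation leaves the bispectrum at \<open>1 + 1\<close> unchanged; with
    \<open>G 1 = a 1\<close> nonzero, it determines the coefficient at 2.\<close>
  have G2: "G 2 = a 2"
  proof -
    have "character s \<xi> * character s \<xi> * cnj (character (s * 2) \<xi>) = 1"
      unfolding cnj_character character_add[symmetric] by simp
    then have "a 1 * a 1 * cnj (a 2) = F s * F s * cnj (F (s * 2))"
      by (simp add: a_def mult_ac)
    then have "a 1 * a 1 * cnj (G 2) = a 1 * a 1 * cnj (a 2)"
      using s(2) G1 by simp
    moreover have "a 1 \<noteq> 0"
      using F1 nrm[of 1] G1 by auto
    ultimately show ?thesis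
      by simp
  qed
  have pos: "G (int k) = a (int k)" if "k > 0" for k
  proof (rule bispectrum_determines[where a = "\<lambda>k. a (int k)" and b = "\<lambda>k. G (int k)"])
    show "norm (G (int k)) = norm (a (int k))" for k
    proof -
      have "norm (a (int k)) = norm (F (int k))"
        using s(1) cnjF[of "int k"] by (cases "s = 1") (auto simp: a_def norm_mult abs_if split: if_splits)
      then show ?thesis
        using nrm by simp
    qed
    show "Re (G (int j) * G (int k) * cnj (G (int (j + k)))) =
        Re (a (int j) * a (int k) * cnj (a (int (j + k))))" if "j > 0" "k > 0" for j k
    proof -
      let ?ks = "[int j, int k, - (int j + int k)]"
      have "Re (prod_list (map a ?ks)) = Re (coeff_product f ?ks)"
      proof -
        have "sum_list ?ks = 0"
          by simp
        then show ?thesis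
          using prod[of ?ks] cnj.sel(1) by metis
      qed
      moreover have "prod_list (map a ?ks) = a (int j) * a (int k) * cnj (a (int (j + k)))"
        using a_uminus[of "int j + int k"] by (simp add: mult.assoc)
      moreover have "coeff_product f ?ks = F (int j) * F (int k) * cnj (F (int (j + k)))"
        using cnjF(1)[of "int j + int k"] by (simp add: coeff_product_def F_def mult.assoc)
      moreover have "Re (G (int j) * G (int k) * cnj (G (int (j + k)))) =
          Re (F (int j) * F (int k) * cnj (F (int (j + k))))"
        using bis[of "int j" "int k"] that by simp
      ultimately show ?thesis
        by (simp only:)
    qed
    show "G (int 1) = a (int 1)" "G (int 2) = a (int 2)"
      using G1 G2 by simp_all
    show "Im (a (int 1) * a (int 1) * cnj (a (int 2))) \<noteq> 0"
      using Im_prod[OF generic_Im_nonzero(1)[OF gen]] by (simp add: a_uminus mult.assoc)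
    show "Im (a (int 1) * a (int 1) * a (int 2) * cnj (a (int 4))) \<noteq> 0"
      using Im_prod[OF generic_Im_nonzero(2)[OF gen]] by (simp add: a_uminus mult.assoc)
    show "Im (a (int 1) * cnj (a (int 2)) * cnj (a (int 3)) * a (int 4)) \<noteq> 0"
      using Im_prod[OF generic_Im_nonzero(3)[OF gen]] by (simp add: a_uminus mult.assoc)
    show "Im (a (int 1) * a (int k) * cnj (a (int 2)) * cnj (a (int (k - 1)))) \<noteq> 0" if "k \<ge> 3" for k
      using Im_prod[OF generic_Im_nonzero(4)[OF gen, of "int k"]] that a_uminus[of "int (k - 1)"]
      by (simp add: a_uminus mult.assoc of_nat_diff)
  qed fact
  \<comment> \<open>Negative indices follow by conjugation, and index 0 from the one-point
    correlation.\<close>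
  have "G k = a k" for k
  proof (cases k "0 :: int" rule: linorder_cases)
    case less
    then show ?thesis
      using pos[of "nat (- k)"] cnjF(2)[of "- k"] a_uminus[of "- k"] by simp
  next
    case equal
    then show ?thesis
      using same_law_mean[OF P] by (simp add: a_def F_def G_def)
  next
    case greater
    then show ?thesis
      using pos[of "nat k"] by simp
  qed
  then show ?thesis
    using that[OF s(1) \<xi>(1)] by (simp add: a_def F_def G_def)
qed

theorem theorem1p6:
  shows "\<exists>\<G>. \<G> \<subseteq> unit_functions \<and> meagre_in (top_of_set unit_functions) \<G> \<and>
    (\<forall>f \<in> unit_functions - \<G>. \<forall>g \<in> unit_functions. \<forall>P_f P_g.
       determinantal_law f P_f \<longrightarrow> determinantal_law g P_g \<longrightarrow> P_g = P_f \<longrightarrow>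
       (\<exists>\<xi>\<in>circle.
          (AE x in circle_measure. rep_linfty g x = rep_linfty f (frac (x + \<xi>))) \<or>
          (AE x in circle_measure. rep_linfty g x = rep_linfty f (frac (- x + \<xi>)))))"
proof (intro exI[of _ "{f \<in> unit_functions. \<not> generic f}"] conjI ballI allI impI)
  show "meagre_in (top_of_set unit_functions) {f \<in> unit_functions. \<not> generic f}"
    by (rule meagre_not_generic)
next
  fix f g P_f P_g
  assume f: "f \<in> unit_functions - {f \<in> unit_functions. \<not> generic f}" and g: "g \<in> unit_functions"
    and P: "determinantal_law f P_f" "determinantal_law g P_g" "P_g = P_f"
  then obtain s \<xi> where s: "\<bar>s\<bar> = 1" and \<xi>: "\<xi> \<in> circle"
    and eq: "\<And>k. fourier_coeff g k = character (s * k) \<xi> * fourier_coeff f (s * k)"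
    using generic_determined[of f P_f g] by auto
  have AE: "AE x in circle_measure. rep_linfty g x = rep_linfty f (rigid s \<xi> x)"
    using f g s eq by (intro eq_rigid_of_fourier_coeff) auto
  consider "s = 1" | "s = - 1"
    using s by linarith
  then show "\<exists>\<xi>\<in>circle.
      (AE x in circle_measure. rep_linfty g x = rep_linfty f (frac (x + \<xi>))) \<or>
      (AE x in circle_measure. rep_linfty g x = rep_linfty f (frac (- x + \<xi>)))"
  proof cases
    case 1
    have "AE x in circle_measure. rep_linfty g x = rep_linfty f (frac (x + \<xi>))"
      using AE unfolding 1 rigid_def by simp
    then show ?thesis
      using \<xi> by blast
  next
    case 2
    have "AE x in circle_measure. rep_linfty g x = rep_linfty f (frac (- x + \<xi>))"
      using AE unfolding 2 rigid_def by simp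
    then show ?thesis
      using \<xi> by blast
  qed
qed auto

end
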